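(* Let $\mathbb{K}$ be a field, $H$ a $\mathbb{K}$-bialgebra with comultiplication $\Delta$, counit $\varepsilon$ and unit $\eta$, $A$ a $\mathbb{K}$-algebra, $\delta:A\to H\otimes A$ an algebra left coaction of $H$ on $A$, $M$ a left $A$-module, and $$\Theta:H\otimes M=(\eta\otimes\mathrm{id}_A)^\ast M\to\delta^\ast M=(H\otimes A)_\delta\otimes_A M$$ a left $(H\otimes A)$-module homomorphism. If $\Theta$ is an isomorphism and $\overline\delta:M\to H\otimes M$, $\overline\delta(m):=\Theta^{-1}(1\otimes m)$, is the module homomorphism over $\delta$ corresponding to $\Theta^{-1}$ via $\delta$, then $$(\mathrm{id}_H\otimes\delta)^\ast\Theta\circ(\eta\otimes\mathrm{id}_{H\otimes A})^\ast\Theta=(\Delta\otimes\mathrm{id}_A)^\ast\Theta\iff(\Delta\otimes\mathrm{id}_M)\circ\overline\delta=(\mathrm{id}_H\otimes\overline\delta)\circ\overline\delta .$$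
   Context: Unadorned tensor products are over $\mathbb{K}$; algebras are associative and unital, modules unital. An algebra left coaction $\delta:A\to H\otimes A$ is a $\mathbb{K}$-algebra homomorphism with $(\Delta\otimes\mathrm{id}_A)\circ\delta=(\mathrm{id}_H\otimes\delta)\circ\delta$ and $(\varepsilon\otimes\mathrm{id}_A)\circ\delta=\mathrm{id}_A$ (with $\mathbb{K}\otimes A=A$). For a $\mathbb{K}$-algebra homomorphism $\varphi:A\to B$ and a left $A$-module $M$, $\varphi^\ast M:=B\otimes_A M$ ($B$ being a right $A$-module via $\varphi$), a left $B$-module, with natural map $M\to\varphi^\ast M$, $m\mapsto 1\otimes m$; for an $A$-module homomorphism $g$, $\varphi^\ast g:=\mathrm{id}_B\otimes_A g$. A module homomorphism over $\varphi$ from an $A$-module $M$ to a $B$-module $N$ is an additive map $\overline\varphi:M\to N$ with $\overline\varphi(am)=\varphi(a)\overline\varphi(m)$; it corresponds via $\varphi$ to the $B$-module homomorphism $f:\varphi^\ast M\to N$ with $f(1\otimes m)=\overline\varphi(m)$. $(H\otimes A)_\delta$ denotes $H\otimes A$ with the right $A$-module structure induced by $\delta$. $H\otimes M$ is a left $(H\otimes A)$-module by $(h\otimes a)(h'\otimes m)=hh'\otimes am$ and is identified with $(\eta\otimes\mathrm{id}_A)^\ast M$ (where $\eta\otimes\mathrm{id}_A:A\to H\otimes A$, $a\mapsto 1\otimes a$) via $(h\otimes a)\otimes m=h\otimes am$. Iterated extensions of scalars of $M$ along pairs of algebra maps with equal composites are identified via the unique isomorphism compatible with the natural maps from $M$.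 Explicitly, the identifications used are $(\eta\otimes\mathrm{id}_{H\otimes A})^\ast\delta^\ast M=(\mathrm{id}_H\otimes\delta)^\ast(\eta\otimes\mathrm{id}_A)^\ast M$, $(\eta\otimes\mathrm{id}_{H\otimes A})^\ast(\eta\otimes\mathrm{id}_A)^\ast M=(\Delta\otimes\mathrm{id}_A)^\ast(\eta\otimes\mathrm{id}_A)^\ast M$, $(\mathrm{id}_H\otimes\delta)^\ast\delta^\ast M=(\Delta\otimes\mathrm{id}_A)^\ast\delta^\ast M$, together with $(H\otimes H)\otimes M=H\otimes(H\otimes M)$. *)

theory Defs
  imports "HOL-Algebra.Module" "HOL-Algebra.Free_Abelian_Groups"
begin

text \<open>
  Modules, over a possibly noncommutative ring, are records of type \<open>('r, 'm) module\<close>; the fields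
  \<open>mult\<close> and \<open>one\<close> of such a record carry meaning only if it is an algebra. The same record type
  serves for right modules: then \<open>smult M r m\<close> stands for $m \cdot r$.
\<close>

locale left_module = R?: ring R + M?: abelian_group M
  for R :: "('r, 'x) ring_scheme" (structure) and M :: "('r, 'm, 'y) module_scheme" (structure) +
  assumes smult_closed: "\<lbrakk>a \<in> carrier R; x \<in> carrier M\<rbrakk> \<Longrightarrow> a \<odot>\<^bsub>M\<^esub> x \<in> carrier M"
    and smult_l_distr: "\<lbrakk>a \<in> carrier R; b \<in> carrier R; x \<in> carrier M\<rbrakk> \<Longrightarrow>
      (a \<oplus> b) \<odot>\<^bsub>M\<^esub> x = a \<odot>\<^bsub>M\<^esub> x \<oplus>\<^bsub>M\<^esub> b \<odot>\<^bsub>M\<^esub> x"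
    and smult_r_distr: "\<lbrakk>a \<in> carrier R; x \<in> carrier M; y \<in> carrier M\<rbrakk> \<Longrightarrow>
      a \<odot>\<^bsub>M\<^esub> (x \<oplus>\<^bsub>M\<^esub> y) = a \<odot>\<^bsub>M\<^esub> x \<oplus>\<^bsub>M\<^esub> a \<odot>\<^bsub>M\<^esub> y"
    and smult_assoc: "\<lbrakk>a \<in> carrier R; b \<in> carrier R; x \<in> carrier M\<rbrakk> \<Longrightarrow>
      (a \<otimes> b) \<odot>\<^bsub>M\<^esub> x = a \<odot>\<^bsub>M\<^esub> (b \<odot>\<^bsub>M\<^esub> x)"
    and smult_one: "x \<in> carrier M \<Longrightarrow> \<one> \<odot>\<^bsub>M\<^esub> x = x"

definition lmod_hom ::
  "('r, 'x) ring_scheme \<Rightarrow> ('r, 'm, 'y) module_scheme \<Rightarrow> ('r, 'n, 'z) module_scheme \<Rightarrow> ('m \<Rightarrow> 'n) set"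
  where "lmod_hom R M N = {f \<in> carrier M \<rightarrow> carrier N.
    (\<forall>x\<in>carrier M. \<forall>y\<in>carrier M. f (x \<oplus>\<^bsub>M\<^esub> y) = f x \<oplus>\<^bsub>N\<^esub> f y) \<and>
    (\<forall>r\<in>carrier R. \<forall>x\<in>carrier M. f (r \<odot>\<^bsub>M\<^esub> x) = r \<odot>\<^bsub>N\<^esub> f x)}"

definition lmod_iso ::
  "('r, 'x) ring_scheme \<Rightarrow> ('r, 'm, 'y) module_scheme \<Rightarrow> ('r, 'n, 'z) module_scheme \<Rightarrow> ('m \<Rightarrow> 'n) set"
  where "lmod_iso R M N = {f \<in> lmod_hom R M N. bij_betw f (carrier M) (carrier N)}"

text \<open>The locale \<open>algebra\<close> of HOL-Algebra assumes commutativity.\<close>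

locale assoc_algebra = K?: field K + module K A + A?: ring A
  for K :: "('k, 'x) ring_scheme" (structure) and A :: "('k, 'a, 'y) module_scheme" (structure) +
  assumes smult_mult_l: "\<lbrakk>k \<in> carrier K; x \<in> carrier A; y \<in> carrier A\<rbrakk> \<Longrightarrow>
      (k \<odot>\<^bsub>A\<^esub> x) \<otimes>\<^bsub>A\<^esub> y = k \<odot>\<^bsub>A\<^esub> (x \<otimes>\<^bsub>A\<^esub> y)"
    and smult_mult_r: "\<lbrakk>k \<in> carrier K; x \<in> carrier A; y \<in> carrier A\<rbrakk> \<Longrightarrow>
      x \<otimes>\<^bsub>A\<^esub> (k \<odot>\<^bsub>A\<^esub> y) = k \<odot>\<^bsub>A\<^esub> (x \<otimes>\<^bsub>A\<^esub> y)"

definition alg_hom ::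
  "('k, 'x) ring_scheme \<Rightarrow> ('k, 'a, 'y) module_scheme \<Rightarrow> ('k, 'b, 'z) module_scheme \<Rightarrow> ('a \<Rightarrow> 'b) set"
  where "alg_hom K A B = {f \<in> ring_hom A B.
    \<forall>k\<in>carrier K. \<forall>x\<in>carrier A. f (k \<odot>\<^bsub>A\<^esub> x) = k \<odot>\<^bsub>B\<^esub> f x}"

definition base_algebra :: "('k, 'x) ring_scheme \<Rightarrow> ('k, 'k) module"
  where "base_algebra K =
    \<lparr>carrier = carrier K, monoid.mult = monoid.mult K, one = one K, ring.zero = ring.zero K, add = add K, smult = monoid.mult K\<rparr>"

definition base_restrict :: "('k, 'a, 'x) module_scheme \<Rightarrow> ('a, 'm, 'y) module_scheme \<Rightarrow> ('k, 'm) module"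
  where "base_restrict A M =
    \<lparr>carrier = carrier M, monoid.mult = monoid.mult M, one = one M, ring.zero = ring.zero M, add = add M,
     smult = (\<lambda>k m. (k \<odot>\<^bsub>A\<^esub> \<one>\<^bsub>A\<^esub>) \<odot>\<^bsub>M\<^esub> m)\<rparr>"


subsection \<open>The tensor product of a right and a left module\<close>

type_synonym ('m, 'n) tensor = "(('m \<times> 'n) \<Rightarrow>\<^sub>0 int) set"

text \<open>
  $M \otimes_R N$ is the free abelian group on $M \times N$ modulo the subgroup generated by the
  usual relators; it is written multiplicatively, as all quotients \<open>G Mod N\<close> are.
\<close>

definition tensor_relators ::
  "('r, 'x) ring_scheme \<Rightarrow> ('r, 'm, 'y) module_scheme \<Rightarrow> ('r, 'n, 'z) module_scheme
    \<Rightarrow> (('m \<times> 'n) \<Rightarrow>\<^sub>0 int) set"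
  where "tensor_relators R M N =
    {frag_of (m \<oplus>\<^bsub>M\<^esub> m', n) - (frag_of (m, n) + frag_of (m', n)) | m m' n.
       m \<in> carrier M \<and> m' \<in> carrier M \<and> n \<in> carrier N} \<union>
    {frag_of (m, n \<oplus>\<^bsub>N\<^esub> n') - (frag_of (m, n) + frag_of (m, n')) | m n n'.
       m \<in> carrier M \<and> n \<in> carrier N \<and> n' \<in> carrier N} \<union>
    {frag_of (r \<odot>\<^bsub>M\<^esub> m, n) - frag_of (m, r \<odot>\<^bsub>N\<^esub> n) | r m n.
       r \<in> carrier R \<and> m \<in> carrier M \<and> n \<in> carrier N}"

definition tensor_null ::
  "('r, 'x) ring_scheme \<Rightarrow> ('r, 'm, 'y) module_scheme \<Rightarrow> ('r, 'n, 'z) module_scheme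
    \<Rightarrow> (('m \<times> 'n) \<Rightarrow>\<^sub>0 int) set"
  where "tensor_null R M N =
    generate (free_Abelian_group (carrier M \<times> carrier N)) (tensor_relators R M N)"

definition tensor_group ::
  "('r, 'x) ring_scheme \<Rightarrow> ('r, 'm, 'y) module_scheme \<Rightarrow> ('r, 'n, 'z) module_scheme
    \<Rightarrow> ('m, 'n) tensor monoid"
  where "tensor_group R M N = free_Abelian_group (carrier M \<times> carrier N) Mod tensor_null R M N"

definition pure_tensor ::
  "('r, 'x) ring_scheme \<Rightarrow> ('r, 'm, 'y) module_scheme \<Rightarrow> ('r, 'n, 'z) module_scheme
    \<Rightarrow> 'm \<Rightarrow> 'n \<Rightarrow> ('m, 'n) tensor"
  where "pure_tensor R M N m n =
    tensor_null R M N #>\<^bsub>free_Abelian_group (carrier M \<times> carrier N)\<^esub> frag_of (m, n)"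

text \<open>
  The group homomorphism on $M \otimes_R N$ given on pure tensors by $m \otimes n \mapsto f(m, n)$.
  It exists, and is then unique, if $f$ is biadditive and $R$-balanced. This holds for all uses
  below, except for the unused multiplication of \<open>tensor_alg\<close> on mere vector spaces.
\<close>

definition tensor_lift ::
  "('r, 'x) ring_scheme \<Rightarrow> ('r, 'm, 'y) module_scheme \<Rightarrow> ('r, 'n, 'z) module_scheme
    \<Rightarrow> ('g, 'w) monoid_scheme \<Rightarrow> ('m \<Rightarrow> 'n \<Rightarrow> 'g) \<Rightarrow> ('m, 'n) tensor \<Rightarrow> 'g"
  where "tensor_lift R M N G f = (THE g.
    g \<in> hom (tensor_group R M N) G \<and> g \<in> extensional (carrier (tensor_group R M N)) \<and>
    (\<forall>m\<in>carrier M. \<forall>n\<in>carrier N. g (pure_tensor R M N m n) = f m n))"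


subsection \<open>Tensor products over the base field\<close>

text \<open>
  For algebras $V$, $W$ this is the algebra $V \otimes W$. If $V$ or $W$ is only a vector space,
  the fields \<open>mult\<close> and \<open>one\<close> are meaningless.
\<close>

definition tensor_alg ::
  "('k, 'x) ring_scheme \<Rightarrow> ('k, 'v, 'y) module_scheme \<Rightarrow> ('k, 'w, 'z) module_scheme
    \<Rightarrow> ('k, ('v, 'w) tensor) module"
  where "tensor_alg K V W = (let T = tensor_group K V W in
    \<lparr>carrier = carrier T,
     monoid.mult = (\<lambda>x y. tensor_lift K V W T (\<lambda>v w. tensor_lift K V W T
       (\<lambda>v' w'. pure_tensor K V W (v \<otimes>\<^bsub>V\<^esub> v') (w \<otimes>\<^bsub>W\<^esub> w')) y) x),
     one = pure_tensor K V W \<one>\<^bsub>V\<^esub> \<one>\<^bsub>W\<^esub>,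
     ring.zero = \<one>\<^bsub>T\<^esub>,
     add = monoid.mult T,
     smult = (\<lambda>k. tensor_lift K V W T (\<lambda>v w. pure_tensor K V W (k \<odot>\<^bsub>V\<^esub> v) w))\<rparr>)"

text \<open>$f \otimes g : V \otimes W \to V' \otimes W'$\<close>

definition tensor_map ::
  "('k, 'x) ring_scheme \<Rightarrow> ('k, 'v, 'a) module_scheme \<Rightarrow> ('k, 'w, 'b) module_scheme
    \<Rightarrow> ('k, 'v2, 'c) module_scheme \<Rightarrow> ('k, 'w2, 'd) module_scheme
    \<Rightarrow> ('v \<Rightarrow> 'v2) \<Rightarrow> ('w \<Rightarrow> 'w2) \<Rightarrow> ('v, 'w) tensor \<Rightarrow> ('v2, 'w2) tensor"
  where "tensor_map K V W V' W' f g =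
    tensor_lift K V W (tensor_group K V' W') (\<lambda>v w. pure_tensor K V' W' (f v) (g w))"

text \<open>The identification $(U \otimes V) \otimes W = U \otimes (V \otimes W)$\<close>

definition tensor_assoc ::
  "('k, 'x) ring_scheme \<Rightarrow> ('k, 'u, 'a) module_scheme \<Rightarrow> ('k, 'v, 'b) module_scheme
    \<Rightarrow> ('k, 'w, 'c) module_scheme
    \<Rightarrow> (('u, 'v) tensor, 'w) tensor \<Rightarrow> ('u, ('v, 'w) tensor) tensor"
  where "tensor_assoc K U V W = (let T = tensor_group K U (tensor_alg K V W) in
    tensor_lift K (tensor_alg K U V) W T (\<lambda>x w. tensor_lift K U V T
      (\<lambda>u v. pure_tensor K U (tensor_alg K V W) u (pure_tensor K V W v w)) x))"

text \<open>The identifications $\mathbb{K} \otimes V = V$ and $V \otimes \mathbb{K} = V$\<close>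

definition left_unitor ::
  "('k, 'x) ring_scheme \<Rightarrow> ('k, 'v, 'a) module_scheme \<Rightarrow> ('k, 'v) tensor \<Rightarrow> 'v"
  where "left_unitor K V = tensor_lift K (base_algebra K) V (add_monoid V) (\<lambda>k v. k \<odot>\<^bsub>V\<^esub> v)"

definition right_unitor ::
  "('k, 'x) ring_scheme \<Rightarrow> ('k, 'v, 'a) module_scheme \<Rightarrow> ('v, 'k) tensor \<Rightarrow> 'v"
  where "right_unitor K V = tensor_lift K V (base_algebra K) (add_monoid V) (\<lambda>v k. k \<odot>\<^bsub>V\<^esub> v)"


subsection \<open>Bialgebras and coactions\<close>

locale bialgebra = assoc_algebra K H
  for K :: "('k, 'x) ring_scheme" (structure) and H :: "('k, 'h, 'y) module_scheme" (structure)
    and \<Delta> :: "'h \<Rightarrow> ('h, 'h) tensor" and \<epsilon> :: "'h \<Rightarrow> 'k" +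
  assumes comult_hom: "\<Delta> \<in> alg_hom K H (tensor_alg K H H)"
    and counit_hom: "\<epsilon> \<in> alg_hom K H (base_algebra K)"
    and coassoc: "h \<in> carrier H \<Longrightarrow>
      tensor_assoc K H H H (tensor_map K H H (tensor_alg K H H) H \<Delta> id (\<Delta> h)) =
      tensor_map K H H H (tensor_alg K H H) id \<Delta> (\<Delta> h)"
    and counit_l: "h \<in> carrier H \<Longrightarrow>
      left_unitor K H (tensor_map K H H (base_algebra K) H \<epsilon> id (\<Delta> h)) = h"
    and counit_r: "h \<in> carrier H \<Longrightarrow>
      right_unitor K H (tensor_map K H H H (base_algebra K) id \<epsilon> (\<Delta> h)) = h"

locale left_coaction = bialgebra K H \<Delta> \<epsilon> + A: assoc_algebra K A
  for K :: "('k, 'x) ring_scheme" (structure) and H :: "('k, 'h, 'y) module_scheme" (structure)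
    and \<Delta> \<epsilon> and A :: "('k, 'a, 'z) module_scheme" (structure)
    and \<delta> :: "'a \<Rightarrow> ('h, 'a) tensor" +
  assumes coaction_hom: "\<delta> \<in> alg_hom K A (tensor_alg K H A)"
    and coaction_coassoc: "a \<in> carrier A \<Longrightarrow>
      tensor_assoc K H H A (tensor_map K H A (tensor_alg K H H) A \<Delta> id (\<delta> a)) =
      tensor_map K H A H (tensor_alg K H A) id \<delta> (\<delta> a)"
    and coaction_counit: "a \<in> carrier A \<Longrightarrow>
      left_unitor K A (tensor_map K H A (base_algebra K) A \<epsilon> id (\<delta> a)) = a"

text \<open>$\eta \otimes \mathrm{id}_V : V \to H \otimes V$, with $V = \mathbb{K} \otimes V$\<close>

definition unit_tensor ::
  "('k, 'x) ring_scheme \<Rightarrow> ('k, 'h, 'a) module_scheme \<Rightarrow> ('k, 'v, 'b) module_scheme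
    \<Rightarrow> 'v \<Rightarrow> ('h, 'v) tensor"
  where "unit_tensor K H V = pure_tensor K H V \<one>\<^bsub>H\<^esub>"

text \<open>$\Delta \otimes \mathrm{id}_V : H \otimes V \to (H \otimes H) \otimes V = H \otimes (H \otimes V)$\<close>

definition comult_tensor ::
  "('k, 'x) ring_scheme \<Rightarrow> ('k, 'h, 'a) module_scheme \<Rightarrow> ('h \<Rightarrow> ('h, 'h) tensor)
    \<Rightarrow> ('k, 'v, 'b) module_scheme \<Rightarrow> ('h, 'v) tensor \<Rightarrow> ('h, ('h, 'v) tensor) tensor"
  where "comult_tensor K H \<Delta> V x =
    tensor_assoc K H H V (tensor_map K H V (tensor_alg K H H) V \<Delta> id x)"

text \<open>$H \otimes M$ as a left $(H \otimes A)$-module, for a left $A$-module $M$\<close>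

definition tensor_mod ::
  "('k, 'x) ring_scheme \<Rightarrow> ('k, 'h, 'a) module_scheme \<Rightarrow> ('k, 'a1, 'b) module_scheme
    \<Rightarrow> ('a1, 'm, 'c) module_scheme \<Rightarrow> (('h, 'a1) tensor, ('h, 'm) tensor) module"
  where "tensor_mod K H A M = (let V = base_restrict A M; T = tensor_group K H V in
    \<lparr>carrier = carrier T, monoid.mult = undefined, one = undefined, ring.zero = \<one>\<^bsub>T\<^esub>, add = monoid.mult T,
     smult = (\<lambda>x t. tensor_lift K H A T (\<lambda>h a. tensor_lift K H V T
       (\<lambda>h' m. pure_tensor K H V (h \<otimes>\<^bsub>H\<^esub> h') (a \<odot>\<^bsub>M\<^esub> m)) t) x)\<rparr>)"


subsection \<open>Extension of scalars\<close>

text \<open>$B$ as a right $A$-module via $\varphi : A \to B$\<close>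

definition right_via ::
  "('b, 'x) ring_scheme \<Rightarrow> ('a \<Rightarrow> 'b) \<Rightarrow> ('a, 'b) module"
  where "right_via B \<phi> =
    \<lparr>carrier = carrier B, monoid.mult = monoid.mult B, one = one B, ring.zero = ring.zero B, add = add B,
     smult = (\<lambda>a b. b \<otimes>\<^bsub>B\<^esub> \<phi> a)\<rparr>"

text \<open>$\varphi^\ast M = B \otimes_A M$\<close>

definition ext_scalars ::
  "('a, 'x) ring_scheme \<Rightarrow> ('b, 'y) ring_scheme \<Rightarrow> ('a \<Rightarrow> 'b) \<Rightarrow> ('a, 'm, 'z) module_scheme
    \<Rightarrow> ('b, ('b, 'm) tensor) module"
  where "ext_scalars A B \<phi> M = (let P = right_via B \<phi>; T = tensor_group A P M in
    \<lparr>carrier = carrier T, monoid.mult = undefined, one = undefined, ring.zero = \<one>\<^bsub>T\<^esub>, add = monoid.mult T,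
     smult = (\<lambda>b. tensor_lift A P M T (\<lambda>b' m. pure_tensor A P M (b \<otimes>\<^bsub>B\<^esub> b') m))\<rparr>)"

text \<open>The natural map $M \to \varphi^\ast M$\<close>

definition ext_unit ::
  "('a, 'x) ring_scheme \<Rightarrow> ('b, 'y) ring_scheme \<Rightarrow> ('a \<Rightarrow> 'b) \<Rightarrow> ('a, 'm, 'z) module_scheme
    \<Rightarrow> 'm \<Rightarrow> ('b, 'm) tensor"
  where "ext_unit A B \<phi> M = pure_tensor A (right_via B \<phi>) M \<one>\<^bsub>B\<^esub>"

text \<open>$\varphi^\ast g = \mathrm{id}_B \otimes_A g : \varphi^\ast M \to \varphi^\ast N$\<close>

definition ext_map ::
  "('a, 'x) ring_scheme \<Rightarrow> ('b, 'y) ring_scheme \<Rightarrow> ('a \<Rightarrow> 'b) \<Rightarrow> ('a, 'm, 'z) module_scheme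
    \<Rightarrow> ('a, 'n, 'w) module_scheme \<Rightarrow> ('m \<Rightarrow> 'n) \<Rightarrow> ('b, 'm) tensor \<Rightarrow> ('b, 'n) tensor"
  where "ext_map A B \<phi> M N g = tensor_lift A (right_via B \<phi>) M (tensor_group A (right_via B \<phi>) N)
    (\<lambda>b m. pure_tensor A (right_via B \<phi>) N b (g m))"

text \<open>
  The identification $\psi^\ast\varphi^\ast M = \psi'^\ast\varphi'^\ast M$ for
  $\varphi : A \to B$, $\psi : B \to C$, $\varphi' : A \to B'$, $\psi' : B' \to C$
  with $\psi\varphi = \psi'\varphi'$
\<close>

definition ext_ident ::
  "('a, 'x) ring_scheme \<Rightarrow> ('b, 'y) ring_scheme \<Rightarrow> ('b2, 'z) ring_scheme \<Rightarrow> ('c, 'w) ring_scheme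
    \<Rightarrow> ('a \<Rightarrow> 'b) \<Rightarrow> ('b \<Rightarrow> 'c) \<Rightarrow> ('a \<Rightarrow> 'b2) \<Rightarrow> ('b2 \<Rightarrow> 'c) \<Rightarrow> ('a, 'm, 'v) module_scheme
    \<Rightarrow> ('c, ('b, 'm) tensor) tensor \<Rightarrow> ('c, ('b2, 'm) tensor) tensor"
  where "ext_ident A B B' C \<phi> \<psi> \<phi>' \<psi>' M =
    (let X = ext_scalars A B \<phi> M; X' = ext_scalars A B' \<phi>' M;
         Y = ext_scalars B C \<psi> X; Y' = ext_scalars B' C \<psi>' X' in
     THE g. g \<in> lmod_iso C Y Y' \<and> g \<in> extensional (carrier Y) \<and>
       (\<forall>m\<in>carrier M. g (ext_unit B C \<psi> X (ext_unit A B \<phi> M m)) =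
         ext_unit B' C \<psi>' X' (ext_unit A B' \<phi>' M m)))"

text \<open>
  The identification $(\eta \otimes \mathrm{id}_A)^\ast M = H \otimes M$,
  $(h \otimes a) \otimes m = h \otimes am$
\<close>

definition ext_unit_tensor_ident ::
  "('k, 'x) ring_scheme \<Rightarrow> ('k, 'h, 'a) module_scheme \<Rightarrow> ('k, 'a1, 'b) module_scheme
    \<Rightarrow> ('a1, 'm, 'c) module_scheme \<Rightarrow> (('h, 'a1) tensor, 'm) tensor \<Rightarrow> ('h, 'm) tensor"
  where "ext_unit_tensor_ident K H A M = (let V = base_restrict A M; T = tensor_group K H V in
    tensor_lift A (right_via (tensor_alg K H A) (unit_tensor K H A)) M T
      (\<lambda>x m. tensor_lift K H A T (\<lambda>h a. pure_tensor K H V h (a \<odot>\<^bsub>M\<^esub> m)) x))"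

end

theory Submission
  imports Defs
begin

text \<open>
  All maps in the cocycle condition are isomorphisms, so it can be replaced by the equation between
  the inverses, which starts from $\Delta_A^\ast\delta^\ast M$ and is linear over
  $H \otimes H \otimes A$; hence it suffices to compare on the elements $1 \otimes (1 \otimes m)$.
  The isomorphism $(\eta \otimes \mathrm{id})^\ast(\eta \otimes \mathrm{id})^\ast M \to H \otimes (H \otimes M)$,
  $(h \otimes c) \otimes x \mapsto h \otimes cx$, turns the values there into
  $(\mathrm{id}_H \otimes \overline\delta)(\overline\delta(m))$ and $(\Delta \otimes \mathrm{id}_M)(\overline\delta(m))$.
\<close>

subsection \<open>Universal property of the tensor product\<close>

text \<open>Passing to inverses is what brings delta-bar in: nothing is prescribed about the values
  of \<Theta> on elements h \<otimes> m, whereas its inverse sends the generator 1 \<otimes> m of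
  the extension along \<delta> to delta-bar(m) by definition. The obstacle is that no identification
  is an equality here. Tensor products are quotients of free abelian groups, so each identification
  of double extensions is a genuine map, picked by a \<open>THE\<close> and attached to a commuting
  square of ring homomorphisms. One square commutes by coassociativity of \<delta>, another because
  \<Delta> preserves the unit. Likewise \<Theta> starts at H \<otimes> M, while extension of scalars
  has to be applied to a map out of the extension along \<eta> \<otimes> id; it is therefore
  composed with the identification of the two. Every map is known by a formula on pure tensors, once
  that formula is shown to be balanced. Since \<Delta>(h) and delta-bar(m) need not be pure, the
  formulas reach them through additivity.\<close>

locale tensor_pair = M: abelian_group M + N: abelian_group N
  for R :: "('r, 'x) ring_scheme" and M :: "('r, 'm, 'y) module_scheme"
    and N :: "('r, 'n, 'z) module_scheme" +
  assumes smult_M: "\<lbrakk>r \<in> carrier R; m \<in> carrier M\<rbrakk> \<Longrightarrow> r \<odot>\<^bsub>M\<^esub> m \<in> carrier M"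
    and smult_N: "\<lbrakk>r \<in> carrier R; n \<in> carrier N\<rbrakk> \<Longrightarrow> r \<odot>\<^bsub>N\<^esub> n \<in> carrier N"
begin

abbreviation "F \<equiv> free_Abelian_group (carrier M \<times> carrier N)"

text \<open>The closure assumptions of the locale enter here. \<open>generate\<close> yields a
  subgroup for generators inside the carrier, so normality of the null subgroup, and with it the
  quotient group, rests on this inclusion.\<close>

lemma relators_subset: "tensor_relators R M N \<subseteq> carrier F"
  unfolding tensor_relators_def
  by (auto dest!: subsetD[OF keys_diff] subsetD[OF keys_add] simp: smult_M smult_N)

lemma null_normal: "tensor_null R M N \<lhd> F"
  unfolding tensor_null_def
  by (rule comm_group.normal_iff_subgroup[THEN iffD2, OF abelian_free_Abelian_group])
    (rule group.generate_is_subgroup[OF group_free_Abelian_group relators_subset])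

lemma comm_group_tensor: "comm_group (tensor_group R M N)"
  unfolding tensor_group_def
  by (rule comm_group.abelian_FactGroup[OF abelian_free_Abelian_group normal_imp_subgroup[OF null_normal]])

sublocale T: comm_group "tensor_group R M N"
  by (rule comm_group_tensor)

lemma coset_hom: "(\<lambda>x. tensor_null R M N #>\<^bsub>F\<^esub> x) \<in> hom F (tensor_group R M N)"
  unfolding tensor_group_def by (rule normal.r_coset_hom_Mod[OF null_normal])

lemma pure_closed [simp]:
  "\<lbrakk>m \<in> carrier M; n \<in> carrier N\<rbrakk> \<Longrightarrow> pure_tensor R M N m n \<in> carrier (tensor_group R M N)"
  unfolding pure_tensor_def by (rule hom_in_carrier[OF coset_hom]) simp

text \<open>The difference x - y is itself the element of the null subgroup that carries y to x.
  Every relator is written as such a difference, so the three tensor relations are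
  instances.\<close>

lemma coset_eq:
  assumes "x - y \<in> tensor_relators R M N" "x \<in> carrier F" "y \<in> carrier F"
  shows "tensor_null R M N #>\<^bsub>F\<^esub> x = tensor_null R M N #>\<^bsub>F\<^esub> y"
proof -
  interpret G: group F by simp
  have "x - y \<in> tensor_null R M N"
    unfolding tensor_null_def using assms(1) by (rule generate.incl)
  then have "x \<in> tensor_null R M N #>\<^bsub>F\<^esub> y"
    by (auto simp: r_coset_def intro!: bexI[of _ "x - y"])
  then show ?thesis
    using assms G.repr_independence[OF _ assms(3) normal_imp_subgroup[OF null_normal]] by simp
qed

lemma pure_add_left:
  assumes "m \<in> carrier M" "m' \<in> carrier M" "n \<in> carrier N"
  shows "pure_tensor R M N (m \<oplus>\<^bsub>M\<^esub> m') n =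
    pure_tensor R M N m n \<otimes>\<^bsub>tensor_group R M N\<^esub> pure_tensor R M N m' n"
proof -
  have "pure_tensor R M N (m \<oplus>\<^bsub>M\<^esub> m') n = tensor_null R M N #>\<^bsub>F\<^esub> (frag_of (m, n) + frag_of (m', n))"
    unfolding pure_tensor_def using assms
    by (intro coset_eq) (auto simp: tensor_relators_def intro!: order_trans[OF keys_add])
  also have "\<dots> = pure_tensor R M N m n \<otimes>\<^bsub>tensor_group R M N\<^esub> pure_tensor R M N m' n"
    unfolding pure_tensor_def using assms hom_mult[OF coset_hom, of "frag_of (m, n)" "frag_of (m', n)"]
    by simp
  finally show ?thesis .
qed

lemma pure_add_right:
  assumes "m \<in> carrier M" "n \<in> carrier N" "n' \<in> carrier N"
  shows "pure_tensor R M N m (n \<oplus>\<^bsub>N\<^esub> n') =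
    pure_tensor R M N m n \<otimes>\<^bsub>tensor_group R M N\<^esub> pure_tensor R M N m n'"
proof -
  have "pure_tensor R M N m (n \<oplus>\<^bsub>N\<^esub> n') = tensor_null R M N #>\<^bsub>F\<^esub> (frag_of (m, n) + frag_of (m, n'))"
    unfolding pure_tensor_def using assms
    by (intro coset_eq) (auto simp: tensor_relators_def intro!: order_trans[OF keys_add])
  also have "\<dots> = pure_tensor R M N m n \<otimes>\<^bsub>tensor_group R M N\<^esub> pure_tensor R M N m n'"
    unfolding pure_tensor_def using assms hom_mult[OF coset_hom, of "frag_of (m, n)" "frag_of (m, n')"]
    by simp
  finally show ?thesis .
qed

lemma pure_balanced:
  assumes "r \<in> carrier R" "m \<in> carrier M" "n \<in> carrier N"
  shows "pure_tensor R M N (r \<odot>\<^bsub>M\<^esub> m) n = pure_tensor R M N m (r \<odot>\<^bsub>N\<^esub> n)"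
  unfolding pure_tensor_def using assms
  by (intro coset_eq) (auto simp: tensor_relators_def smult_M smult_N)

lemma pure_zero_left:
  assumes "n \<in> carrier N"
  shows "pure_tensor R M N \<zero>\<^bsub>M\<^esub> n = \<one>\<^bsub>tensor_group R M N\<^esub>"
  using pure_add_left[of "\<zero>\<^bsub>M\<^esub>" "\<zero>\<^bsub>M\<^esub>" n] assms by (simp add: T.l_cancel_one')

lemma pure_minus_left:
  assumes "m \<in> carrier M" "n \<in> carrier N"
  shows "inv\<^bsub>tensor_group R M N\<^esub> pure_tensor R M N m n = pure_tensor R M N (\<ominus>\<^bsub>M\<^esub> m) n"
  using pure_add_left[of "\<ominus>\<^bsub>M\<^esub> m" m n] assms
  by (intro T.inv_equality) (simp_all add: M.l_neg pure_zero_left)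

text \<open>Unit and inverses call for no cases of their own: the unit is 0 \<otimes> 0 and the
  inverse of m \<otimes> n is (-m) \<otimes> n, so sums of pure tensors exhaust the group.\<close>

lemma tensor_induct [consumes 1, case_names pure add]:
  assumes "x \<in> carrier (tensor_group R M N)"
    and pure: "\<And>m n. \<lbrakk>m \<in> carrier M; n \<in> carrier N\<rbrakk> \<Longrightarrow> P (pure_tensor R M N m n)"
    and add: "\<And>x y. \<lbrakk>x \<in> carrier (tensor_group R M N); y \<in> carrier (tensor_group R M N); P x; P y\<rbrakk>
      \<Longrightarrow> P (x \<otimes>\<^bsub>tensor_group R M N\<^esub> y)"
  shows "P x"
proof -
  let ?T = "tensor_group R M N" and ?c = "\<lambda>c. tensor_null R M N #>\<^bsub>F\<^esub> c"
  interpret c: group_hom F ?T ?c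
    by (simp add: coset_hom group_hom_def group_hom_axioms_def T.is_group)
  \<comment> \<open>The inverse is carried along because induction on the free abelian group has a
    step for differences x - y instead of sums.\<close>
  have "P (?c c) \<and> P (inv\<^bsub>?T\<^esub> ?c c)" if "Poly_Mapping.keys c \<subseteq> carrier M \<times> carrier N" for c
  proof (induction c rule: free_Abelian_group_induct[where S = "carrier M \<times> carrier N"])
    case 1
    then show ?case by (rule that)
  next
    case 2
    have "P \<one>\<^bsub>?T\<^esub>"
      using pure[of "\<zero>\<^bsub>M\<^esub>" "\<zero>\<^bsub>N\<^esub>"] pure_zero_left[of "\<zero>\<^bsub>N\<^esub>"] by simp
    then show ?case using c.hom_one by simp
  next
    case (3 x y)
    have "?c (x - y) = ?c x \<otimes>\<^bsub>?T\<^esub> inv\<^bsub>?T\<^esub> ?c y"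
      using 3 c.hom_mult[of x "-y"] c.hom_inv[of y] by simp
    moreover have "inv\<^bsub>?T\<^esub> (?c x \<otimes>\<^bsub>?T\<^esub> inv\<^bsub>?T\<^esub> ?c y) = inv\<^bsub>?T\<^esub> ?c x \<otimes>\<^bsub>?T\<^esub> ?c y"
      using 3 c.hom_closed[of x] c.hom_closed[of y] by (simp add: T.inv_mult)
    ultimately show ?case
      using 3 c.hom_closed[of x] c.hom_closed[of y] by (simp add: add)
  next
    case (4 a)
    then obtain m n where "a = (m, n)" "m \<in> carrier M" "n \<in> carrier N" by auto
    then show ?case
      using pure[of m n] pure[of "\<ominus>\<^bsub>M\<^esub> m" n] pure_minus_left[of m n]
      by (simp add: pure_tensor_def)
  qed
  moreover obtain c where "Poly_Mapping.keys c \<subseteq> carrier M \<times> carrier N" "x = ?c c"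
    using assms(1) unfolding tensor_group_def FactGroup_def RCOSETS_def by auto
  ultimately show ?thesis by blast
qed

lemma tensor_hom_eqI:
  assumes "x \<in> carrier (tensor_group R M N)"
    and "g \<in> hom (tensor_group R M N) G" "h \<in> hom (tensor_group R M N) G"
    and "\<And>m n. \<lbrakk>m \<in> carrier M; n \<in> carrier N\<rbrakk> \<Longrightarrow> g (pure_tensor R M N m n) = h (pure_tensor R M N m n)"
  shows "g x = h x"
  using assms(1) by (induction rule: tensor_induct) (simp_all add: assms(4) hom_mult[OF assms(2)] hom_mult[OF assms(3)])

end

section \<open>Balanced maps and the homomorphisms that they induce\<close>

definition balanced where
  "balanced R M N G f \<longleftrightarrow>
    (\<forall>m\<in>carrier M. \<forall>n\<in>carrier N. f m n \<in> carrier G) \<and>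
    (\<forall>m\<in>carrier M. \<forall>m'\<in>carrier M. \<forall>n\<in>carrier N. f (m \<oplus>\<^bsub>M\<^esub> m') n = f m n \<otimes>\<^bsub>G\<^esub> f m' n) \<and>
    (\<forall>m\<in>carrier M. \<forall>n\<in>carrier N. \<forall>n'\<in>carrier N. f m (n \<oplus>\<^bsub>N\<^esub> n') = f m n \<otimes>\<^bsub>G\<^esub> f m n') \<and>
    (\<forall>r\<in>carrier R. \<forall>m\<in>carrier M. \<forall>n\<in>carrier N. f (r \<odot>\<^bsub>M\<^esub> m) n = f m (r \<odot>\<^bsub>N\<^esub> n))"

lemma balancedI:
  assumes "\<And>m n. \<lbrakk>m \<in> carrier M; n \<in> carrier N\<rbrakk> \<Longrightarrow> f m n \<in> carrier G"
    and "\<And>m m' n. \<lbrakk>m \<in> carrier M; m' \<in> carrier M; n \<in> carrier N\<rbrakk> \<Longrightarrow> f (m \<oplus>\<^bsub>M\<^esub> m') n = f m n \<otimes>\<^bsub>G\<^esub> f m' n"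
    and "\<And>m n n'. \<lbrakk>m \<in> carrier M; n \<in> carrier N; n' \<in> carrier N\<rbrakk> \<Longrightarrow> f m (n \<oplus>\<^bsub>N\<^esub> n') = f m n \<otimes>\<^bsub>G\<^esub> f m n'"
    and "\<And>r m n. \<lbrakk>r \<in> carrier R; m \<in> carrier M; n \<in> carrier N\<rbrakk> \<Longrightarrow> f (r \<odot>\<^bsub>M\<^esub> m) n = f m (r \<odot>\<^bsub>N\<^esub> n)"
  shows "balanced R M N G f"
  using assms by (auto simp: balanced_def)

text \<open>The free abelian group extends f to a homomorphism h. Each of the three kinds of
  relators is killed by h through one of the three equations of balancedness; the kernel, being a
  subgroup, then contains the null subgroup, and h factors through the quotient.\<close>

lemma (in tensor_pair) tensor_lift_exists:
  assumes "comm_group G" "balanced R M N G f"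
  obtains g where "g \<in> hom (tensor_group R M N) G"
    "\<And>m n. \<lbrakk>m \<in> carrier M; n \<in> carrier N\<rbrakk> \<Longrightarrow> g (pure_tensor R M N m n) = f m n"
proof -
  interpret G: comm_group G by fact
  have "case_prod f ` (carrier M \<times> carrier N) \<subseteq> carrier G"
    using assms(2) by (auto simp: balanced_def)
  then obtain h where h: "h \<in> hom F G" "\<And>x. x \<in> carrier M \<times> carrier N \<Longrightarrow> h (frag_of x) = case_prod f x"
    using G.free_Abelian_group_universal by blast
  interpret h: group_hom F G h
    by (simp add: h(1) group_hom_def group_hom_axioms_def G.is_group)
  have h_diff: "h (x - y) = h x \<otimes>\<^bsub>G\<^esub> inv\<^bsub>G\<^esub> h y" if "x \<in> carrier F" "y \<in> carrier F" for x y
    using h.hom_mult[of x "-y"] h.hom_inv[of y] that by simp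
  have h_add: "h (x + y) = h x \<otimes>\<^bsub>G\<^esub> h y" if "x \<in> carrier F" "y \<in> carrier F" for x y
    using h.hom_mult[of x y] that by simp
  have F_add: "x + y \<in> carrier F" if "x \<in> carrier F" "y \<in> carrier F" for x y
    using h.G.m_closed[OF that] by simp
  have "tensor_relators R M N \<subseteq> kernel F G h"
  proof
    fix x assume x: "x \<in> tensor_relators R M N"
    have "h x = \<one>\<^bsub>G\<^esub>"
      using x unfolding tensor_relators_def
      by (elim UnE CollectE exE conjE)
        (use assms(2) in \<open>simp_all add: h_diff h_add F_add h(2) balanced_def smult_M smult_N
          del: carrier_free_Abelian_group_iff\<close>)
    then show "x \<in> kernel F G h"
      using subsetD[OF relators_subset x] by (simp add: kernel_def)
  qed
  then have "tensor_null R M N \<subseteq> kernel F G h"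
    unfolding tensor_null_def by (rule h.G.generate_subgroup_incl) (rule h.subgroup_kernel)
  then obtain g where "g \<in> hom (F Mod tensor_null R M N) G"
    "\<And>x. x \<in> carrier F \<Longrightarrow> g (tensor_null R M N #>\<^bsub>F\<^esub> x) = h x"
    using h.FactGroup_universal_kernel[OF null_normal] by metis
  with h(2) show thesis
    by (intro that[of g]) (auto simp: tensor_group_def pure_tensor_def)
qed

text \<open>Discharges the \<open>THE\<close>: a homomorphism that exists is made extensional by
  restriction, and any other candidate agrees with it on pure tensors, hence everywhere. From here
  on \<open>tensor_lift\<close> is handled through these two facts.\<close>

lemma (in tensor_pair) tensor_lift:
  assumes "comm_group G" "balanced R M N G f"
  shows tensor_lift_hom: "tensor_lift R M N G f \<in> hom (tensor_group R M N) G"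
    and tensor_lift_pure: "\<lbrakk>m \<in> carrier M; n \<in> carrier N\<rbrakk> \<Longrightarrow>
      tensor_lift R M N G f (pure_tensor R M N m n) = f m n"
proof -
  let ?T = "tensor_group R M N"
  let ?P = "\<lambda>g. g \<in> hom ?T G \<and> g \<in> extensional (carrier ?T) \<and>
    (\<forall>m\<in>carrier M. \<forall>n\<in>carrier N. g (pure_tensor R M N m n) = f m n)"
  obtain g where g: "g \<in> hom ?T G"
    "\<And>m n. \<lbrakk>m \<in> carrier M; n \<in> carrier N\<rbrakk> \<Longrightarrow> g (pure_tensor R M N m n) = f m n"
    using tensor_lift_exists[OF assms] by blast
  have "?P (restrict g (carrier ?T))"
    using g by (auto simp: hom_def)
  moreover have "k = restrict g (carrier ?T)" if "?P k" for k
  proof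
    fix x show "k x = restrict g (carrier ?T) x"
      using that g tensor_hom_eqI[of x k G g] by (cases "x \<in> carrier ?T") (auto simp: extensional_def)
  qed
  ultimately have "?P (tensor_lift R M N G f)"
    unfolding tensor_lift_def by (rule theI)
  then show "tensor_lift R M N G f \<in> hom ?T G" and "\<lbrakk>m \<in> carrier M; n \<in> carrier N\<rbrakk> \<Longrightarrow>
      tensor_lift R M N G f (pure_tensor R M N m n) = f m n"
    by auto
qed

subsection \<open>Tensor products over the base field\<close>

lemma lmod_homI:
  assumes "\<And>x. x \<in> carrier M \<Longrightarrow> f x \<in> carrier N"
    and "\<And>x y. \<lbrakk>x \<in> carrier M; y \<in> carrier M\<rbrakk> \<Longrightarrow> f (x \<oplus>\<^bsub>M\<^esub> y) = f x \<oplus>\<^bsub>N\<^esub> f y"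
    and "\<And>r x. \<lbrakk>r \<in> carrier R; x \<in> carrier M\<rbrakk> \<Longrightarrow> f (r \<odot>\<^bsub>M\<^esub> x) = r \<odot>\<^bsub>N\<^esub> f x"
  shows "f \<in> lmod_hom R M N"
  using assms by (auto simp: lmod_hom_def)

lemma lmod_homD:
  assumes "f \<in> lmod_hom R M N"
  shows lmod_hom_closed: "x \<in> carrier M \<Longrightarrow> f x \<in> carrier N"
    and lmod_hom_add: "\<lbrakk>x \<in> carrier M; y \<in> carrier M\<rbrakk> \<Longrightarrow> f (x \<oplus>\<^bsub>M\<^esub> y) = f x \<oplus>\<^bsub>N\<^esub> f y"
    and lmod_hom_smult: "\<lbrakk>r \<in> carrier R; x \<in> carrier M\<rbrakk> \<Longrightarrow> f (r \<odot>\<^bsub>M\<^esub> x) = r \<odot>\<^bsub>N\<^esub> f x"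
  using assms by (auto simp: lmod_hom_def)

lemma lmod_hom_id: "id \<in> lmod_hom R M M"
  by (auto simp: lmod_hom_def)

lemma lmod_hom_comp:
  "\<lbrakk>f \<in> lmod_hom R M N; g \<in> lmod_hom R N P\<rbrakk> \<Longrightarrow> g \<circ> f \<in> lmod_hom R M P"
  by (auto simp: lmod_hom_def Pi_iff)

lemma alg_hom_imp_lmod_hom: "f \<in> alg_hom K A B \<Longrightarrow> f \<in> lmod_hom K A B"
  by (auto simp: alg_hom_def lmod_hom_def ring_hom_def)

lemma alg_hom_imp_ring_hom: "f \<in> alg_hom K A B \<Longrightarrow> f \<in> ring_hom A B"
  by (auto simp: alg_hom_def)

lemma alg_homI:
  assumes "f \<in> lmod_hom K A B" "f \<one>\<^bsub>A\<^esub> = \<one>\<^bsub>B\<^esub>"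
    and "\<And>x y. \<lbrakk>x \<in> carrier A; y \<in> carrier A\<rbrakk> \<Longrightarrow> f (x \<otimes>\<^bsub>A\<^esub> y) = f x \<otimes>\<^bsub>B\<^esub> f y"
  shows "f \<in> alg_hom K A B"
  using assms by (auto simp: alg_hom_def lmod_hom_def ring_hom_def)

lemma alg_hom_id: "id \<in> alg_hom K A A"
  by (auto simp: alg_hom_def ring_hom_def)

lemma alg_hom_comp:
  "\<lbrakk>f \<in> alg_hom K A B; g \<in> alg_hom K B C\<rbrakk> \<Longrightarrow> g \<circ> f \<in> alg_hom K A C"
  by (auto simp: alg_hom_def ring_hom_def Pi_iff)

text \<open>Quotient groups are multiplicative, modules use the additive fields of a record. This is
  the bridge for all records below whose addition is copied from a commutative group.\<close>

lemma abelian_group_of_comm_group: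
  assumes "comm_group G" "carrier X = carrier G" "add X = monoid.mult G" "ring.zero X = one G"
  shows "abelian_group X"
proof -
  interpret comm_group G by fact
  show ?thesis
    by (rule abelian_groupI) (use l_inv in \<open>auto simp: assms m_ac\<close>)
qed

section \<open>The K-module V \<otimes> W\<close>

lemma tensor_alg_simps [simp]:
  "carrier (tensor_alg K V W) = carrier (tensor_group K V W)"
  "add (tensor_alg K V W) = monoid.mult (tensor_group K V W)"
  "ring.zero (tensor_alg K V W) = one (tensor_group K V W)"
  "one (tensor_alg K V W) = pure_tensor K V W \<one>\<^bsub>V\<^esub> \<one>\<^bsub>W\<^esub>"
  by (simp_all add: tensor_alg_def Let_def)

lemma module_tensor_pair: "\<lbrakk>module K V; module K W\<rbrakk> \<Longrightarrow> tensor_pair K V W"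
  unfolding tensor_pair_def tensor_pair_axioms_def
  by (auto simp: module_def module_axioms_def)

lemma module_abelian_group: "module K V \<Longrightarrow> abelian_group V"
  by (simp add: module_def)

text \<open>Scaling the left factor by k is compatible with the balancing scalars because K is
  commutative.\<close>

lemma module_balanced_smult:
  assumes "module K V" "module K W" "k \<in> carrier K"
  shows "balanced K V W (tensor_group K V W) (\<lambda>v w. pure_tensor K V W (k \<odot>\<^bsub>V\<^esub> v) w)"
proof -
  interpret V: module K V by fact
  interpret W: module K W by fact
  interpret VW: tensor_pair K V W using assms by (intro module_tensor_pair)
  show ?thesis
    using assms(3)
    by (intro balancedI) (simp_all add: V.smult_r_distr VW.pure_add_left VW.pure_add_right VW.pure_balanced
        V.smult_assoc1 [symmetric] W.smult_assoc1 [symmetric] V.R.m_comm)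
qed

lemma tensor_smult:
  assumes "module K V" "module K W" "k \<in> carrier K"
  shows tensor_smult_pure: "\<lbrakk>v \<in> carrier V; w \<in> carrier W\<rbrakk> \<Longrightarrow>
      k \<odot>\<^bsub>tensor_alg K V W\<^esub> pure_tensor K V W v w = pure_tensor K V W (k \<odot>\<^bsub>V\<^esub> v) w"
    and tensor_smult_hom: "(\<lambda>x. k \<odot>\<^bsub>tensor_alg K V W\<^esub> x) \<in> hom (tensor_group K V W) (tensor_group K V W)"
proof -
  interpret VW: tensor_pair K V W using assms by (intro module_tensor_pair)
  have eq: "(\<lambda>x. k \<odot>\<^bsub>tensor_alg K V W\<^esub> x) =
      tensor_lift K V W (tensor_group K V W) (\<lambda>v w. pure_tensor K V W (k \<odot>\<^bsub>V\<^esub> v) w)"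
    by (simp add: tensor_alg_def Let_def)
  note lift = VW.tensor_lift[OF VW.comm_group_tensor module_balanced_smult[OF assms]]
  show "(\<lambda>x. k \<odot>\<^bsub>tensor_alg K V W\<^esub> x) \<in> hom (tensor_group K V W) (tensor_group K V W)"
    unfolding eq by (rule lift)
  show "\<lbrakk>v \<in> carrier V; w \<in> carrier W\<rbrakk> \<Longrightarrow>
      k \<odot>\<^bsub>tensor_alg K V W\<^esub> pure_tensor K V W v w = pure_tensor K V W (k \<odot>\<^bsub>V\<^esub> v) w"
    using lift(2) by (simp add: fun_cong[OF eq])
qed

lemma module_tensor_alg:
  assumes "module K V" "module K W"
  shows "module K (tensor_alg K V W)"
proof -
  interpret V: module K V by fact
  interpret W: module K W by fact
  interpret VW: tensor_pair K V W using assms by (intro module_tensor_pair)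
  let ?T = "tensor_group K V W"
  note smult_pure = tensor_smult_pure[OF assms]
    and smult_add = hom_mult[OF tensor_smult_hom[OF assms]]
    and smult_closed = hom_in_carrier[OF tensor_smult_hom[OF assms]]
  show ?thesis
  proof (rule moduleI)
    show "abelian_group (tensor_alg K V W)"
      using VW.comm_group_tensor by (rule abelian_group_of_comm_group) simp_all
    fix k l x assume kl: "k \<in> carrier K" "l \<in> carrier K" "x \<in> carrier (tensor_alg K V W)"
    then have "x \<in> carrier ?T" by simp
    then show "(k \<oplus>\<^bsub>K\<^esub> l) \<odot>\<^bsub>tensor_alg K V W\<^esub> x =
        k \<odot>\<^bsub>tensor_alg K V W\<^esub> x \<oplus>\<^bsub>tensor_alg K V W\<^esub> l \<odot>\<^bsub>tensor_alg K V W\<^esub> x"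
      by (induction rule: VW.tensor_induct)
        (use kl in \<open>simp_all add: smult_pure V.smult_l_distr VW.pure_add_left smult_add smult_closed VW.T.m_ac\<close>)
    from \<open>x \<in> carrier ?T\<close> show "(k \<otimes>\<^bsub>K\<^esub> l) \<odot>\<^bsub>tensor_alg K V W\<^esub> x =
        k \<odot>\<^bsub>tensor_alg K V W\<^esub> (l \<odot>\<^bsub>tensor_alg K V W\<^esub> x)"
      by (induction rule: VW.tensor_induct)
        (use kl in \<open>simp_all add: smult_pure V.smult_assoc1 smult_add smult_closed\<close>)
  next
    fix x assume "x \<in> carrier (tensor_alg K V W)"
    then have "x \<in> carrier ?T" by simp
    then show "\<one>\<^bsub>K\<^esub> \<odot>\<^bsub>tensor_alg K V W\<^esub> x = x"
      by (induction rule: VW.tensor_induct) (simp_all add: smult_pure smult_add)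
  qed (simp_all add: V.R.is_cring smult_add smult_closed)
qed

section \<open>Bilinear maps and their tensor product\<close>

definition bilinear where
  "bilinear K U V W \<mu> \<longleftrightarrow>
    (\<forall>u\<in>carrier U. \<mu> u \<in> lmod_hom K V W) \<and>
    (\<forall>v\<in>carrier V. (\<lambda>u. \<mu> u v) \<in> lmod_hom K U W)"

lemma bilinearD:
  assumes "bilinear K U V W \<mu>"
  shows "\<lbrakk>u \<in> carrier U; v \<in> carrier V\<rbrakk> \<Longrightarrow> \<mu> u v \<in> carrier W"
    and "\<lbrakk>u \<in> carrier U; u' \<in> carrier U; v \<in> carrier V\<rbrakk> \<Longrightarrow> \<mu> (u \<oplus>\<^bsub>U\<^esub> u') v = \<mu> u v \<oplus>\<^bsub>W\<^esub> \<mu> u' v"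
    and "\<lbrakk>u \<in> carrier U; v \<in> carrier V; v' \<in> carrier V\<rbrakk> \<Longrightarrow> \<mu> u (v \<oplus>\<^bsub>V\<^esub> v') = \<mu> u v \<oplus>\<^bsub>W\<^esub> \<mu> u v'"
    and "\<lbrakk>k \<in> carrier K; u \<in> carrier U; v \<in> carrier V\<rbrakk> \<Longrightarrow> \<mu> (k \<odot>\<^bsub>U\<^esub> u) v = k \<odot>\<^bsub>W\<^esub> \<mu> u v"
    and "\<lbrakk>k \<in> carrier K; u \<in> carrier U; v \<in> carrier V\<rbrakk> \<Longrightarrow> \<mu> u (k \<odot>\<^bsub>V\<^esub> v) = k \<odot>\<^bsub>W\<^esub> \<mu> u v"
  using assms by (auto simp: bilinear_def lmod_hom_def)

lemma assoc_algebra_module: "assoc_algebra K A \<Longrightarrow> module K A"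
  by (simp add: assoc_algebra_def)

lemma assoc_algebra_bilinear_mult:
  assumes "assoc_algebra K A"
  shows "bilinear K A A A (monoid.mult A)"
proof -
  interpret assoc_algebra K A by fact
  show ?thesis
    by (auto simp: bilinear_def lmod_hom_def A.l_distr A.r_distr smult_mult_l smult_mult_r)
qed

text \<open>
  Both the multiplication of $V \otimes W$ and the action of $H \otimes A$ on $H \otimes M$ are
  instances of \<open>tensor_action\<close>.
\<close>

definition tensor_action where
  "tensor_action K U A V W V' W' \<mu> \<nu> x t =
    tensor_lift K U A (tensor_group K V' W') (\<lambda>u a. tensor_lift K V W (tensor_group K V' W')
      (\<lambda>v w. pure_tensor K V' W' (\<mu> u v) (\<nu> a w)) t) x"

text \<open>Two nested lifts. For fixed u and a, the assignment v \<otimes> w to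
  \<open>\<mu> u v\<close> \<otimes> \<open>\<nu> a w\<close> descends to V \<otimes> W; its value
  at a fixed t is in turn balanced in u and a, so it descends to U \<otimes> A.\<close>

lemma tensor_action:
  assumes modules: "module K U" "module K A" "module K V" "module K W" "module K V'" "module K W'"
    and \<mu>: "bilinear K U V V' \<mu>" and \<nu>: "bilinear K A W W' \<nu>"
  shows tensor_action_pure:
      "\<lbrakk>u \<in> carrier U; a \<in> carrier A; v \<in> carrier V; w \<in> carrier W\<rbrakk> \<Longrightarrow>
        tensor_action K U A V W V' W' \<mu> \<nu> (pure_tensor K U A u a) (pure_tensor K V W v w) =
        pure_tensor K V' W' (\<mu> u v) (\<nu> a w)"
    and tensor_action_hom_left: "t \<in> carrier (tensor_group K V W) \<Longrightarrow>
        (\<lambda>x. tensor_action K U A V W V' W' \<mu> \<nu> x t) \<in> hom (tensor_group K U A) (tensor_group K V' W')"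
    and tensor_action_hom_right: "x \<in> carrier (tensor_group K U A) \<Longrightarrow>
        tensor_action K U A V W V' W' \<mu> \<nu> x \<in> hom (tensor_group K V W) (tensor_group K V' W')"
proof -
  interpret U: module K U by fact
  interpret A: module K A by fact
  interpret V: module K V by fact
  interpret W: module K W by fact
  interpret UA: tensor_pair K U A using modules by (intro module_tensor_pair)
  interpret VW: tensor_pair K V W using modules by (intro module_tensor_pair)
  interpret VW': tensor_pair K V' W' using modules by (intro module_tensor_pair)
  note bl = bilinearD[OF \<mu>] bilinearD[OF \<nu>]
  let ?T = "tensor_group K V' W'"
  let ?i = "\<lambda>u a. tensor_lift K V W ?T (\<lambda>v w. pure_tensor K V' W' (\<mu> u v) (\<nu> a w))"
  have bal: "balanced K V W ?T (\<lambda>v w. pure_tensor K V' W' (\<mu> u v) (\<nu> a w))"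
    if "u \<in> carrier U" "a \<in> carrier A" for u a
    using that by (intro balancedI) (simp_all add: bl VW'.pure_add_left VW'.pure_add_right VW'.pure_balanced)
  note i_hom = VW.tensor_lift_hom[OF VW'.comm_group_tensor bal]
    and i_pure = VW.tensor_lift_pure[OF VW'.comm_group_tensor bal]
  note i = hom_mult[OF i_hom] hom_in_carrier[OF i_hom] i_pure
  \<comment> \<open>At a pure t this is bilinearity of \<mu> and \<nu>; additivity of the inner lift
    extends it to all t.\<close>
  have bal2: "balanced K U A ?T (\<lambda>u a. ?i u a t)" if t: "t \<in> carrier (tensor_group K V W)" for t
  proof (rule balancedI)
    show "?i u a t \<in> carrier ?T" if "u \<in> carrier U" "a \<in> carrier A" for u a
      using that t by (simp add: i)
    show "?i (u \<oplus>\<^bsub>U\<^esub> u') a t = ?i u a t \<otimes>\<^bsub>?T\<^esub> ?i u' a t"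
      if "u \<in> carrier U" "u' \<in> carrier U" "a \<in> carrier A" for u u' a
      using t by (induction rule: VW.tensor_induct)
        (use that in \<open>simp_all add: i bl VW'.pure_add_left VW'.T.m_ac\<close>)
    show "?i u (a \<oplus>\<^bsub>A\<^esub> a') t = ?i u a t \<otimes>\<^bsub>?T\<^esub> ?i u a' t"
      if "u \<in> carrier U" "a \<in> carrier A" "a' \<in> carrier A" for u a a'
      using t by (induction rule: VW.tensor_induct)
        (use that in \<open>simp_all add: i bl VW'.pure_add_right VW'.T.m_ac\<close>)
    show "?i (k \<odot>\<^bsub>U\<^esub> u) a t = ?i u (k \<odot>\<^bsub>A\<^esub> a) t"
      if "k \<in> carrier K" "u \<in> carrier U" "a \<in> carrier A" for k u a
      using t by (induction rule: VW.tensor_induct)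
        (use that in \<open>simp_all add: i bl VW'.pure_balanced\<close>)
  qed
  note lift2 = UA.tensor_lift[OF VW'.comm_group_tensor bal2]
  show left: "(\<lambda>x. tensor_action K U A V W V' W' \<mu> \<nu> x t) \<in> hom (tensor_group K U A) ?T"
    if "t \<in> carrier (tensor_group K V W)" for t
    using lift2(1)[OF that] by (simp add: tensor_action_def)
  have act_pure: "tensor_action K U A V W V' W' \<mu> \<nu> (pure_tensor K U A u a) t = ?i u a t"
    if "t \<in> carrier (tensor_group K V W)" "u \<in> carrier U" "a \<in> carrier A" for t u a
    unfolding tensor_action_def using that by (intro lift2(2))
  show "tensor_action K U A V W V' W' \<mu> \<nu> (pure_tensor K U A u a) (pure_tensor K V W v w) =
        pure_tensor K V' W' (\<mu> u v) (\<nu> a w)"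
    if "u \<in> carrier U" "a \<in> carrier A" "v \<in> carrier V" "w \<in> carrier W" for u a v w
    using that by (simp add: act_pure i)
  note l = hom_mult[OF left] hom_in_carrier[OF left]
  \<comment> \<open>The outer lift gives additivity in x only. Additivity in t follows by induction
    on x, since a pure x acts as an inner lift, which is a homomorphism in t.\<close>
  show "tensor_action K U A V W V' W' \<mu> \<nu> x \<in> hom (tensor_group K V W) ?T"
    if x: "x \<in> carrier (tensor_group K U A)" for x
  proof (rule homI)
    show "tensor_action K U A V W V' W' \<mu> \<nu> x t \<in> carrier ?T" if "t \<in> carrier (tensor_group K V W)" for t
      using that x by (simp add: l)
    show "tensor_action K U A V W V' W' \<mu> \<nu> x (s \<otimes>\<^bsub>tensor_group K V W\<^esub> t) =
        tensor_action K U A V W V' W' \<mu> \<nu> x s \<otimes>\<^bsub>?T\<^esub> tensor_action K U A V W V' W' \<mu> \<nu> x t"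
      if "s \<in> carrier (tensor_group K V W)" "t \<in> carrier (tensor_group K V W)" for s t
      using x by (induction rule: UA.tensor_induct)
        (use that in \<open>simp_all add: l act_pure i VW'.T.m_ac\<close>)
  qed
qed

section \<open>The algebra V \<otimes> W\<close>

lemma tensor_alg_mult:
  "monoid.mult (tensor_alg K V W) = tensor_action K V W V W V W (monoid.mult V) (monoid.mult W)"
  by (simp add: fun_eq_iff tensor_alg_def tensor_action_def Let_def)

lemma assoc_algebra_tensor_mult:
  assumes "assoc_algebra K V" "assoc_algebra K W"
  shows tensor_mult_pure:
      "\<lbrakk>v \<in> carrier V; w \<in> carrier W; v' \<in> carrier V; w' \<in> carrier W\<rbrakk> \<Longrightarrow>
        pure_tensor K V W v w \<otimes>\<^bsub>tensor_alg K V W\<^esub> pure_tensor K V W v' w' =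
        pure_tensor K V W (v \<otimes>\<^bsub>V\<^esub> v') (w \<otimes>\<^bsub>W\<^esub> w')"
    and tensor_mult_closed: "\<lbrakk>x \<in> carrier (tensor_group K V W); y \<in> carrier (tensor_group K V W)\<rbrakk> \<Longrightarrow>
        x \<otimes>\<^bsub>tensor_alg K V W\<^esub> y \<in> carrier (tensor_group K V W)"
    and tensor_mult_add_left:
      "\<lbrakk>x \<in> carrier (tensor_group K V W); y \<in> carrier (tensor_group K V W); z \<in> carrier (tensor_group K V W)\<rbrakk> \<Longrightarrow>
        (x \<otimes>\<^bsub>tensor_group K V W\<^esub> y) \<otimes>\<^bsub>tensor_alg K V W\<^esub> z =
        (x \<otimes>\<^bsub>tensor_alg K V W\<^esub> z) \<otimes>\<^bsub>tensor_group K V W\<^esub> (y \<otimes>\<^bsub>tensor_alg K V W\<^esub> z)"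
    and tensor_mult_add_right:
      "\<lbrakk>x \<in> carrier (tensor_group K V W); y \<in> carrier (tensor_group K V W); z \<in> carrier (tensor_group K V W)\<rbrakk> \<Longrightarrow>
        x \<otimes>\<^bsub>tensor_alg K V W\<^esub> (y \<otimes>\<^bsub>tensor_group K V W\<^esub> z) =
        (x \<otimes>\<^bsub>tensor_alg K V W\<^esub> y) \<otimes>\<^bsub>tensor_group K V W\<^esub> (x \<otimes>\<^bsub>tensor_alg K V W\<^esub> z)"
proof -
  note act = tensor_action[OF assms[THEN assoc_algebra_module] assms[THEN assoc_algebra_module]
    assms[THEN assoc_algebra_module] assms[THEN assoc_algebra_bilinear_mult], folded tensor_alg_mult]
  show "\<lbrakk>v \<in> carrier V; w \<in> carrier W; v' \<in> carrier V; w' \<in> carrier W\<rbrakk> \<Longrightarrow>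
        pure_tensor K V W v w \<otimes>\<^bsub>tensor_alg K V W\<^esub> pure_tensor K V W v' w' =
        pure_tensor K V W (v \<otimes>\<^bsub>V\<^esub> v') (w \<otimes>\<^bsub>W\<^esub> w')" for v w v' w'
    by (rule act)
  show "\<lbrakk>x \<in> carrier (tensor_group K V W); y \<in> carrier (tensor_group K V W)\<rbrakk> \<Longrightarrow>
        x \<otimes>\<^bsub>tensor_alg K V W\<^esub> y \<in> carrier (tensor_group K V W)" for x y
    by (rule hom_in_carrier[OF act(2)])
  show "\<lbrakk>x \<in> carrier (tensor_group K V W); y \<in> carrier (tensor_group K V W); z \<in> carrier (tensor_group K V W)\<rbrakk> \<Longrightarrow>
        (x \<otimes>\<^bsub>tensor_group K V W\<^esub> y) \<otimes>\<^bsub>tensor_alg K V W\<^esub> z =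
        (x \<otimes>\<^bsub>tensor_alg K V W\<^esub> z) \<otimes>\<^bsub>tensor_group K V W\<^esub> (y \<otimes>\<^bsub>tensor_alg K V W\<^esub> z)" for x y z
    by (rule hom_mult[OF act(2)])
  show "\<lbrakk>x \<in> carrier (tensor_group K V W); y \<in> carrier (tensor_group K V W); z \<in> carrier (tensor_group K V W)\<rbrakk> \<Longrightarrow>
        x \<otimes>\<^bsub>tensor_alg K V W\<^esub> (y \<otimes>\<^bsub>tensor_group K V W\<^esub> z) =
        (x \<otimes>\<^bsub>tensor_alg K V W\<^esub> y) \<otimes>\<^bsub>tensor_group K V W\<^esub> (x \<otimes>\<^bsub>tensor_alg K V W\<^esub> z)" for x y z
    by (rule hom_mult[OF act(3)])
qed

text \<open>Multiplication and scalar action are additive in every tensor argument, so the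
  identities reduce to pure tensors, where they hold factor by factor.\<close>

lemma assoc_algebra_tensor_alg:
  assumes "assoc_algebra K V" "assoc_algebra K W"
  shows "assoc_algebra K (tensor_alg K V W)"
proof -
  interpret V: assoc_algebra K V by fact
  interpret W: assoc_algebra K W by fact
  note modules = assms[THEN assoc_algebra_module]
  interpret VW: tensor_pair K V W using modules by (rule module_tensor_pair)
  interpret T: module K "tensor_alg K V W" using modules by (rule module_tensor_alg)
  let ?T = "tensor_group K V W" and ?A = "tensor_alg K V W"
  note m = assoc_algebra_tensor_mult[OF assms]
  note s = tensor_smult_pure[OF modules] hom_mult[OF tensor_smult_hom[OF modules]]
    hom_in_carrier[OF tensor_smult_hom[OF modules]]
  have assoc: "(x \<otimes>\<^bsub>?A\<^esub> y) \<otimes>\<^bsub>?A\<^esub> z = x \<otimes>\<^bsub>?A\<^esub> (y \<otimes>\<^bsub>?A\<^esub> z)"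
    if x: "x \<in> carrier ?T" and y: "y \<in> carrier ?T" and z: "z \<in> carrier ?T" for x y z
    using x
  proof (induction rule: VW.tensor_induct)
    case p: (pure v w)
    from y show ?case
    proof (induction rule: VW.tensor_induct)
      case (pure v' w')
      from z show ?case
        by (induction rule: VW.tensor_induct) (use p pure in \<open>simp_all add: m V.A.m_assoc W.A.m_assoc\<close>)
    qed (use p z in \<open>simp_all add: m\<close>)
  qed (use y z in \<open>simp_all add: m\<close>)
  have ident: "\<one>\<^bsub>?A\<^esub> \<otimes>\<^bsub>?A\<^esub> x = x \<and> x \<otimes>\<^bsub>?A\<^esub> \<one>\<^bsub>?A\<^esub> = x" if "x \<in> carrier ?T" for x
    using that by (induction rule: VW.tensor_induct) (simp_all add: m)
  have "ring ?A"
  proof (rule ringI)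
    show "abelian_group ?A" using T.module_axioms by (rule module_abelian_group)
    show "monoid ?A"
      by (rule monoidI) (use ident in \<open>simp_all add: assoc m\<close>)
  qed (simp_all add: m)
  moreover have "(k \<odot>\<^bsub>?A\<^esub> x) \<otimes>\<^bsub>?A\<^esub> y = k \<odot>\<^bsub>?A\<^esub> (x \<otimes>\<^bsub>?A\<^esub> y) \<and>
      x \<otimes>\<^bsub>?A\<^esub> (k \<odot>\<^bsub>?A\<^esub> y) = k \<odot>\<^bsub>?A\<^esub> (x \<otimes>\<^bsub>?A\<^esub> y)"
    if k: "k \<in> carrier K" and x: "x \<in> carrier ?T" and y: "y \<in> carrier ?T" for k x y
    using x
  proof (induction rule: VW.tensor_induct)
    case p: (pure v w)
    from y show ?case
      by (induction rule: VW.tensor_induct)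
        (use p k in \<open>simp_all add: m s V.smult_mult_l V.smult_mult_r\<close>)
  qed (use y k in \<open>simp_all add: m s\<close>)
  ultimately show ?thesis
    by (simp add: assoc_algebra_def assoc_algebra_axioms_def V.K.field_axioms T.module_axioms)
qed

section \<open>Tensor products of homomorphisms\<close>

lemma tensor_map:
  assumes modules: "module K V" "module K W" "module K V'" "module K W'"
    and f: "f \<in> lmod_hom K V V'" and g: "g \<in> lmod_hom K W W'"
  shows tensor_map_pure: "\<lbrakk>v \<in> carrier V; w \<in> carrier W\<rbrakk> \<Longrightarrow>
      tensor_map K V W V' W' f g (pure_tensor K V W v w) = pure_tensor K V' W' (f v) (g w)"
    and tensor_map_lmod_hom:
      "tensor_map K V W V' W' f g \<in> lmod_hom K (tensor_alg K V W) (tensor_alg K V' W')"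
proof -
  interpret V: module K V by fact
  interpret VW: tensor_pair K V W using modules by (intro module_tensor_pair)
  interpret VW': tensor_pair K V' W' using modules by (intro module_tensor_pair)
  note fg = lmod_homD[OF f] lmod_homD[OF g]
  have bal: "balanced K V W (tensor_group K V' W') (\<lambda>v w. pure_tensor K V' W' (f v) (g w))"
    by (intro balancedI) (simp_all add: fg VW'.pure_add_left VW'.pure_add_right VW'.pure_balanced)
  note lift = VW.tensor_lift[OF VW'.comm_group_tensor bal, folded tensor_map_def]
  show pure: "tensor_map K V W V' W' f g (pure_tensor K V W v w) = pure_tensor K V' W' (f v) (g w)"
    if "v \<in> carrier V" "w \<in> carrier W" for v w
    using that by (rule lift)
  note hom = hom_mult[OF lift(1)] hom_in_carrier[OF lift(1)]
  note s = tensor_smult_pure hom_mult[OF tensor_smult_hom] hom_in_carrier[OF tensor_smult_hom]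
  show "tensor_map K V W V' W' f g \<in> lmod_hom K (tensor_alg K V W) (tensor_alg K V' W')"
  proof (rule lmod_homI)
    fix k x assume k: "k \<in> carrier K" and "x \<in> carrier (tensor_alg K V W)"
    then have "x \<in> carrier (tensor_group K V W)" by simp
    then show "tensor_map K V W V' W' f g (k \<odot>\<^bsub>tensor_alg K V W\<^esub> x) =
        k \<odot>\<^bsub>tensor_alg K V' W'\<^esub> tensor_map K V W V' W' f g x"
      by (induction rule: VW.tensor_induct) (simp_all add: s modules k hom pure fg)
  qed (simp_all add: hom)
qed

lemma tensor_map_alg_hom:
  assumes algebras: "assoc_algebra K V" "assoc_algebra K W" "assoc_algebra K V'" "assoc_algebra K W'"
    and f: "f \<in> alg_hom K V V'" and g: "g \<in> alg_hom K W W'"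
  shows "tensor_map K V W V' W' f g \<in> alg_hom K (tensor_alg K V W) (tensor_alg K V' W')"
proof -
  note modules = algebras[THEN assoc_algebra_module]
  interpret V: assoc_algebra K V by fact
  interpret W: assoc_algebra K W by fact
  interpret VW: tensor_pair K V W using modules by (intro module_tensor_pair)
  interpret VW': tensor_pair K V' W' using modules by (intro module_tensor_pair)
  let ?F = "tensor_map K V W V' W' f g"
  note fg = f[THEN alg_hom_imp_lmod_hom] g[THEN alg_hom_imp_lmod_hom]
  note rh = alg_hom_imp_ring_hom[OF f] alg_hom_imp_ring_hom[OF g]
  note F = tensor_map_pure[OF modules fg] lmod_homD[OF tensor_map_lmod_hom[OF modules fg], simplified]
    lmod_homD[OF fg(1)] lmod_homD[OF fg(2)]
    ring_hom_mult[OF rh(1)] ring_hom_mult[OF rh(2)] ring_hom_one[OF rh(1)] ring_hom_one[OF rh(2)]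
  note m = assoc_algebra_tensor_mult[OF algebras(1,2)] assoc_algebra_tensor_mult[OF algebras(3,4)]
  show ?thesis
  proof (rule alg_homI)
    show "?F \<in> lmod_hom K (tensor_alg K V W) (tensor_alg K V' W')"
      using modules fg by (rule tensor_map_lmod_hom)
    show "?F \<one>\<^bsub>tensor_alg K V W\<^esub> = \<one>\<^bsub>tensor_alg K V' W'\<^esub>"
      by (simp add: F)
    fix x y assume "x \<in> carrier (tensor_alg K V W)" "y \<in> carrier (tensor_alg K V W)"
    then have x: "x \<in> carrier (tensor_group K V W)" and y: "y \<in> carrier (tensor_group K V W)" by auto
    from x show "?F (x \<otimes>\<^bsub>tensor_alg K V W\<^esub> y) = ?F x \<otimes>\<^bsub>tensor_alg K V' W'\<^esub> ?F y"
    proof (induction rule: VW.tensor_induct)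
      case p: (pure v w)
      from y show ?case
        by (induction rule: VW.tensor_induct) (use p in \<open>simp_all add: m F\<close>)
    qed (use y in \<open>simp_all add: m F\<close>)
  qed
qed

section \<open>The associator\<close>

lemma tensor_assoc:
  assumes modules: "module K U" "module K V" "module K W"
  shows tensor_assoc_pure: "\<lbrakk>u \<in> carrier U; v \<in> carrier V; w \<in> carrier W\<rbrakk> \<Longrightarrow>
      tensor_assoc K U V W (pure_tensor K (tensor_alg K U V) W (pure_tensor K U V u v) w) =
      pure_tensor K U (tensor_alg K V W) u (pure_tensor K V W v w)"
    and tensor_assoc_lmod_hom: "tensor_assoc K U V W \<in>
      lmod_hom K (tensor_alg K (tensor_alg K U V) W) (tensor_alg K U (tensor_alg K V W))"
proof -
  note modules' = module_tensor_alg[OF modules(1,2)] module_tensor_alg[OF modules(2,3)]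
  interpret U: module K U by fact
  interpret UV: tensor_pair K U V using modules by (intro module_tensor_pair)
  interpret VW: tensor_pair K V W using modules by (intro module_tensor_pair)
  interpret L: tensor_pair K "tensor_alg K U V" W using modules modules' by (intro module_tensor_pair)
  interpret R: tensor_pair K U "tensor_alg K V W" using modules modules' by (intro module_tensor_pair)
  let ?T = "tensor_group K U (tensor_alg K V W)"
  let ?i = "\<lambda>w. tensor_lift K U V ?T
      (\<lambda>u v. pure_tensor K U (tensor_alg K V W) u (pure_tensor K V W v w))"
  note s = tensor_smult_pure hom_mult[OF tensor_smult_hom] hom_in_carrier[OF tensor_smult_hom]
  \<comment> \<open>The simp set rewrites the addition of \<open>tensor_alg K V W\<close> to the
    product of the tensor group; the rule has to be in that form in order to apply. The same reason
    lies behind the later uses of \<open>[simplified]\<close> on such rules.\<close>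
  note Radd = R.pure_add_left R.pure_add_right[simplified]
  have bal: "balanced K U V ?T (\<lambda>u v. pure_tensor K U (tensor_alg K V W) u (pure_tensor K V W v w))"
    if "w \<in> carrier W" for w
    using that by (intro balancedI)
      (simp_all add: VW.pure_add_left Radd R.pure_balanced s modules)
  note lift = UV.tensor_lift[OF R.comm_group_tensor bal]
  note i = hom_mult[OF lift(1)] hom_in_carrier[OF lift(1)] lift(2)
  have bal2: "balanced K (tensor_alg K U V) W ?T (\<lambda>x w. ?i w x)"
  proof (rule balancedI)
    show "?i (w \<oplus>\<^bsub>W\<^esub> w') x = ?i w x \<otimes>\<^bsub>?T\<^esub> ?i w' x"
      if "x \<in> carrier (tensor_alg K U V)" "w \<in> carrier W" "w' \<in> carrier W" for x w w'
    proof -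
      have "x \<in> carrier (tensor_group K U V)" using that by simp
      then show ?thesis
        by (induction rule: UV.tensor_induct)
          (use that in \<open>simp_all add: i VW.pure_add_right Radd R.T.m_ac\<close>)
    qed
    \<comment> \<open>The scalar travels from u to v \<otimes> w by balancedness of the outer
      product, and from v to w by that of the inner one.\<close>
    show "?i w (k \<odot>\<^bsub>tensor_alg K U V\<^esub> x) = ?i (k \<odot>\<^bsub>W\<^esub> w) x"
      if "k \<in> carrier K" "x \<in> carrier (tensor_alg K U V)" "w \<in> carrier W" for k x w
    proof -
      have "x \<in> carrier (tensor_group K U V)" using that by simp
      then show ?thesis
        by (induction rule: UV.tensor_induct)
          (use that in \<open>simp_all add: i s modules VW.smult_N UV.smult_M R.pure_balanced VW.pure_balanced [symmetric]\<close>)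
    qed
  qed (simp_all add: i)
  note lift2 = L.tensor_lift[OF R.comm_group_tensor bal2]
  have eq: "tensor_assoc K U V W = tensor_lift K (tensor_alg K U V) W ?T (\<lambda>x w. ?i w x)"
    by (simp add: tensor_assoc_def Let_def)
  show pure: "tensor_assoc K U V W (pure_tensor K (tensor_alg K U V) W (pure_tensor K U V u v) w) =
      pure_tensor K U (tensor_alg K V W) u (pure_tensor K V W v w)"
    if "u \<in> carrier U" "v \<in> carrier V" "w \<in> carrier W" for u v w
    using that by (simp add: eq lift2(2) i)
  note hom = hom_mult[OF lift2(1), folded eq] hom_in_carrier[OF lift2(1), folded eq]
  show "tensor_assoc K U V W \<in>
      lmod_hom K (tensor_alg K (tensor_alg K U V) W) (tensor_alg K U (tensor_alg K V W))"
  proof (rule lmod_homI)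
    fix k x assume k: "k \<in> carrier K" and "x \<in> carrier (tensor_alg K (tensor_alg K U V) W)"
    then have "x \<in> carrier (tensor_group K (tensor_alg K U V) W)" by simp
    then show "tensor_assoc K U V W (k \<odot>\<^bsub>tensor_alg K (tensor_alg K U V) W\<^esub> x) =
        k \<odot>\<^bsub>tensor_alg K U (tensor_alg K V W)\<^esub> tensor_assoc K U V W x"
    proof (induction rule: L.tensor_induct)
      case p: (pure y w)
      then have "y \<in> carrier (tensor_group K U V)" by simp
      then show ?case
      proof (induction rule: UV.tensor_induct)
        case (add x y)
        then show ?case
          using p k L.pure_add_left[of x y w] L.pure_add_left[of "k \<odot>\<^bsub>tensor_alg K U V\<^esub> x" "k \<odot>\<^bsub>tensor_alg K U V\<^esub> y" w]
          by (simp add: s modules modules' hom)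
      qed (use p k in \<open>simp_all add: s modules modules' pure UV.smult_M\<close>)
    qed (use k in \<open>simp_all add: s modules modules' hom\<close>)
  qed (simp_all add: hom)
qed

lemma tensor_assoc_alg_hom:
  assumes algebras: "assoc_algebra K U" "assoc_algebra K V" "assoc_algebra K W"
  shows "tensor_assoc K U V W \<in>
      alg_hom K (tensor_alg K (tensor_alg K U V) W) (tensor_alg K U (tensor_alg K V W))"
proof -
  note modules = algebras[THEN assoc_algebra_module]
  note algebras' = assoc_algebra_tensor_alg[OF algebras(1,2)] assoc_algebra_tensor_alg[OF algebras(2,3)]
  note modules' = algebras'[THEN assoc_algebra_module]
  interpret U: assoc_algebra K U by fact
  interpret V: assoc_algebra K V by fact
  interpret W: assoc_algebra K W by fact
  interpret UV: tensor_pair K U V using modules by (intro module_tensor_pair)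
  interpret VW: tensor_pair K V W using modules by (intro module_tensor_pair)
  interpret L: tensor_pair K "tensor_alg K U V" W using modules modules' by (intro module_tensor_pair)
  interpret R: tensor_pair K U "tensor_alg K V W" using modules modules' by (intro module_tensor_pair)
  let ?L = "tensor_alg K (tensor_alg K U V) W" and ?R = "tensor_alg K U (tensor_alg K V W)"
  let ?F = "tensor_assoc K U V W"
  note F = tensor_assoc_pure[OF modules] lmod_homD[OF tensor_assoc_lmod_hom[OF modules], simplified]
  note m = assoc_algebra_tensor_mult[OF algebras(1,2)] assoc_algebra_tensor_mult[OF algebras(2,3)]
    assoc_algebra_tensor_mult[OF algebras'(1) algebras(3), simplified]
    assoc_algebra_tensor_mult[OF algebras(1) algebras'(2), simplified]
  \<comment> \<open>The elements (u \<otimes> v) \<otimes> w generate additively, because a sum in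
    the left factor splits into a sum of pure tensors.\<close>
  have induct: "P x" if "x \<in> carrier (tensor_group K (tensor_alg K U V) W)"
    and "\<And>u v w. \<lbrakk>u \<in> carrier U; v \<in> carrier V; w \<in> carrier W\<rbrakk> \<Longrightarrow>
      P (pure_tensor K (tensor_alg K U V) W (pure_tensor K U V u v) w)"
    and add: "\<And>x y. \<lbrakk>x \<in> carrier (tensor_group K (tensor_alg K U V) W);
        y \<in> carrier (tensor_group K (tensor_alg K U V) W); P x; P y\<rbrakk> \<Longrightarrow>
      P (x \<otimes>\<^bsub>tensor_group K (tensor_alg K U V) W\<^esub> y)" for P x
    using that(1)
  proof (induction rule: L.tensor_induct)
    case p: (pure y w)
    then have "y \<in> carrier (tensor_group K U V)" by simp
    then show ?case
    proof (induction rule: UV.tensor_induct)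
      case (add x y)
      with p that(3) show ?case using L.pure_add_left[of x y w] by simp
    qed (use p that(2) in auto)
  qed (rule that(3))
  show ?thesis
  proof (rule alg_homI)
    show "?F \<in> lmod_hom K ?L ?R"
      using modules by (rule tensor_assoc_lmod_hom)
    show "?F \<one>\<^bsub>?L\<^esub> = \<one>\<^bsub>?R\<^esub>"
      by (simp add: F)
    fix x y assume "x \<in> carrier ?L" "y \<in> carrier ?L"
    then have x: "x \<in> carrier (tensor_group K (tensor_alg K U V) W)"
      and y: "y \<in> carrier (tensor_group K (tensor_alg K U V) W)" by auto
    show "?F (x \<otimes>\<^bsub>?L\<^esub> y) = ?F x \<otimes>\<^bsub>?R\<^esub> ?F y"
    proof (rule induct[OF x])
      fix u v w assume p: "u \<in> carrier U" "v \<in> carrier V" "w \<in> carrier W"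
      let ?x = "pure_tensor K (tensor_alg K U V) W (pure_tensor K U V u v) w"
      show "?F (?x \<otimes>\<^bsub>?L\<^esub> y) = ?F ?x \<otimes>\<^bsub>?R\<^esub> ?F y"
        by (rule induct[OF y]) (simp_all add: p m F)
    qed (simp_all add: y m F)
  qed
qed

section \<open>The maps \<Delta> \<otimes> id and \<eta> \<otimes> id\<close>

lemma comult_tensor_eq:
  "comult_tensor K H \<Delta> V = tensor_assoc K H H V \<circ> tensor_map K H V (tensor_alg K H H) V \<Delta> id"
  by (simp add: fun_eq_iff comult_tensor_def)

lemma comult_tensor_lmod_hom:
  assumes "module K H" "module K V" "\<Delta> \<in> lmod_hom K H (tensor_alg K H H)"
  shows "comult_tensor K H \<Delta> V \<in> lmod_hom K (tensor_alg K H V) (tensor_alg K H (tensor_alg K H V))"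
  unfolding comult_tensor_eq using assms
  by (intro lmod_hom_comp[OF tensor_map_lmod_hom tensor_assoc_lmod_hom] module_tensor_alg lmod_hom_id)

lemma comult_tensor_pure:
  assumes "module K H" "module K V" "\<Delta> \<in> lmod_hom K H (tensor_alg K H H)"
    and "h \<in> carrier H" "v \<in> carrier V"
  shows "comult_tensor K H \<Delta> V (pure_tensor K H V h v) =
    tensor_assoc K H H V (pure_tensor K (tensor_alg K H H) V (\<Delta> h) v)"
  using assms by (simp add: comult_tensor_eq tensor_map_pure module_tensor_alg lmod_hom_id)

lemma comult_tensor_alg_hom:
  assumes "assoc_algebra K H" "assoc_algebra K V" "\<Delta> \<in> alg_hom K H (tensor_alg K H H)"
  shows "comult_tensor K H \<Delta> V \<in> alg_hom K (tensor_alg K H V) (tensor_alg K H (tensor_alg K H V))"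
  unfolding comult_tensor_eq using assms
  by (intro alg_hom_comp[OF tensor_map_alg_hom tensor_assoc_alg_hom] assoc_algebra_tensor_alg alg_hom_id)

lemma unit_tensor_alg_hom:
  assumes "assoc_algebra K H" "assoc_algebra K A"
  shows "unit_tensor K H A \<in> alg_hom K A (tensor_alg K H A)"
proof -
  interpret H: assoc_algebra K H by fact
  interpret A: assoc_algebra K A by fact
  note modules = assms[THEN assoc_algebra_module]
  interpret HA: tensor_pair K H A using modules by (rule module_tensor_pair)
  show ?thesis
    by (intro alg_homI lmod_homI)
      (simp_all add: unit_tensor_def HA.pure_add_right HA.pure_balanced tensor_smult_pure modules
        assoc_algebra_tensor_mult[OF assms])
qed

section \<open>H \<otimes> M as a module over H \<otimes> A\<close>

lemma base_restrict_simps [simp]: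
  "carrier (base_restrict A M) = carrier M"
  "add (base_restrict A M) = add M"
  "ring.zero (base_restrict A M) = ring.zero M"
  "k \<odot>\<^bsub>base_restrict A M\<^esub> m = (k \<odot>\<^bsub>A\<^esub> \<one>\<^bsub>A\<^esub>) \<odot>\<^bsub>M\<^esub> m"
  by (simp_all add: base_restrict_def)

text \<open>The elements k1 are central in A, and multiplication by them is the scalar action. It is
  through them that \<open>base_restrict\<close> lets K act on an A-module.\<close>

lemma (in assoc_algebra) smult_one_mult:
  assumes "k \<in> carrier K" "a \<in> carrier A"
  shows "(k \<odot>\<^bsub>A\<^esub> \<one>\<^bsub>A\<^esub>) \<otimes>\<^bsub>A\<^esub> a = k \<odot>\<^bsub>A\<^esub> a" "a \<otimes>\<^bsub>A\<^esub> (k \<odot>\<^bsub>A\<^esub> \<one>\<^bsub>A\<^esub>) = k \<odot>\<^bsub>A\<^esub> a"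
  using assms by (simp_all add: smult_mult_l smult_mult_r)

lemma module_base_restrict:
  assumes "assoc_algebra K A" "left_module A M"
  shows "module K (base_restrict A M)"
proof -
  interpret A: assoc_algebra K A by fact
  interpret M: left_module A M by fact
  show ?thesis
  proof (rule moduleI)
    show "cring K" using assoc_algebra_module[OF assms(1)] by (rule module.axioms)
    show "abelian_group (base_restrict A M)"
      using M.M.a_comm_group by (rule abelian_group_of_comm_group) simp_all
    fix k l x assume "k \<in> carrier K" "l \<in> carrier K" "x \<in> carrier (base_restrict A M)"
    then show "(k \<otimes>\<^bsub>K\<^esub> l) \<odot>\<^bsub>base_restrict A M\<^esub> x =
        k \<odot>\<^bsub>base_restrict A M\<^esub> (l \<odot>\<^bsub>base_restrict A M\<^esub> x)"
      by (simp add: M.smult_assoc [symmetric] A.smult_one_mult(1) A.smult_assoc1)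
  qed (simp_all add: M.smult_closed A.smult_l_distr M.smult_l_distr M.smult_r_distr M.smult_one)
qed

lemma bilinear_smult:
  assumes "assoc_algebra K A" "left_module A M"
  shows "bilinear K A (base_restrict A M) (base_restrict A M) (smult M)"
proof -
  interpret A: assoc_algebra K A by fact
  interpret M: left_module A M by fact
  show ?thesis
    unfolding bilinear_def
    by (intro conjI ballI lmod_homI)
      (simp_all add: M.smult_closed M.smult_l_distr M.smult_r_distr M.smult_assoc [symmetric] A.smult_one_mult)
qed

lemma tensor_mod_simps [simp]:
  "carrier (tensor_mod K H A M) = carrier (tensor_group K H (base_restrict A M))"
  "add (tensor_mod K H A M) = monoid.mult (tensor_group K H (base_restrict A M))"
  by (simp_all add: tensor_mod_def Let_def)

lemma tensor_mod_smult:
  "smult (tensor_mod K H A M) =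
    tensor_action K H A H (base_restrict A M) H (base_restrict A M) (monoid.mult H) (smult M)"
  by (simp add: fun_eq_iff tensor_mod_def tensor_action_def Let_def)

text \<open>K acts on H \<otimes> M through H \<otimes> A and also as on a tensor product of vector
  spaces. Their agreement allows an (H \<otimes> A)-linear map into H \<otimes> M to be used as a
  K-linear one, as \<open>tensor_map\<close> demands.\<close>

lemma tensor_mod_smult_one:
  assumes "assoc_algebra K H" "assoc_algebra K A" "left_module A M"
    and k: "k \<in> carrier K" and "t \<in> carrier (tensor_group K H (base_restrict A M))"
  shows "(k \<odot>\<^bsub>tensor_alg K H A\<^esub> \<one>\<^bsub>tensor_alg K H A\<^esub>) \<odot>\<^bsub>tensor_mod K H A M\<^esub> t =
    k \<odot>\<^bsub>tensor_alg K H (base_restrict A M)\<^esub> t"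
proof -
  interpret H: assoc_algebra K H by fact
  interpret A: assoc_algebra K A by fact
  interpret M: left_module A M by fact
  note modules = assms(1,2)[THEN assoc_algebra_module] module_base_restrict[OF assms(2,3)]
  interpret HA: tensor_pair K H A using modules by (intro module_tensor_pair)
  interpret HV: tensor_pair K H "base_restrict A M" using modules by (intro module_tensor_pair)
  note act = tensor_action[OF modules(1,2,1,3,1,3) assoc_algebra_bilinear_mult[OF assms(1)]
      bilinear_smult[OF assms(2,3)], folded tensor_mod_smult]
  note s = tensor_smult_pure hom_mult[OF tensor_smult_hom] hom_in_carrier[OF tensor_smult_hom]
  show ?thesis
    using assms(5)
    by (induction rule: HV.tensor_induct)
      (simp_all add: s modules k act(1) hom_mult[OF act(3)] H.smult_one_mult M.smult_one)
qed

subsection \<open>Extension of scalars\<close>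

lemma lmod_isoI:
  assumes "f \<in> lmod_hom R M N" "g \<in> carrier N \<rightarrow> carrier M"
    and "\<And>x. x \<in> carrier M \<Longrightarrow> g (f x) = x" "\<And>y. y \<in> carrier N \<Longrightarrow> f (g y) = y"
  shows "f \<in> lmod_iso R M N"
  unfolding lmod_iso_def using assms(1)
  by (auto intro!: bij_betw_byWitness[where f' = g] simp: assms(3,4) funcset_mem[OF assms(2)] lmod_hom_closed)

lemma lmod_iso_inv_into:
  assumes "f \<in> lmod_iso R M N" "left_module R M"
  shows "inv_into (carrier M) f \<in> lmod_hom R N M"
proof -
  interpret M: left_module R M by fact
  let ?g = "inv_into (carrier M) f"
  have f: "f \<in> lmod_hom R M N" and bij: "bij_betw f (carrier M) (carrier N)"
    using assms(1) by (auto simp: lmod_iso_def)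
  have g: "?g y \<in> carrier M" "f (?g y) = y" if "y \<in> carrier N" for y
    using that bij by (auto simp: bij_betw_inv_into_right bij_betw_def inv_into_into)
  \<comment> \<open>Injectivity recognises the value of the inverse from any preimage in the
    carrier; sums and multiples of preimages are such, by linearity of f.\<close>
  have inj: "?g y = x" if "x \<in> carrier M" "f x = y" for x y
    using that bij_betw_inv_into_left[OF bij] by auto
  show ?thesis
    by (intro lmod_homI inj)
      (simp_all add: g M.smult_closed lmod_hom_add[OF f] lmod_hom_smult[OF f])
qed

section \<open>A single extension of scalars\<close>

lemma right_via_simps [simp]:
  "carrier (right_via B \<phi>) = carrier B"
  "add (right_via B \<phi>) = add B"
  "ring.zero (right_via B \<phi>) = ring.zero B"
  "a \<odot>\<^bsub>right_via B \<phi>\<^esub> b = b \<otimes>\<^bsub>B\<^esub> \<phi> a"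
  by (simp_all add: right_via_def)

lemma ext_scalars_simps [simp]:
  "carrier (ext_scalars A B \<phi> M) = carrier (tensor_group A (right_via B \<phi>) M)"
  "add (ext_scalars A B \<phi> M) = monoid.mult (tensor_group A (right_via B \<phi>) M)"
  "ring.zero (ext_scalars A B \<phi> M) = one (tensor_group A (right_via B \<phi>) M)"
  by (simp_all add: ext_scalars_def Let_def)

locale scalar_extension = B: ring B + M: left_module A M
  for A :: "('a, 'x) ring_scheme" and B :: "('b, 'y) ring_scheme" and \<phi> :: "'a \<Rightarrow> 'b"
    and M :: "('a, 'm, 'z) module_scheme" +
  assumes \<phi>: "\<phi> \<in> ring_hom A B"
begin

lemmas \<phi>_simps [simp] =
  ring_hom_closed[OF \<phi>] ring_hom_mult[OF \<phi>] ring_hom_add[OF \<phi>] ring_hom_one[OF \<phi>]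

lemma abelian_group_right_via: "abelian_group (right_via B \<phi>)"
  using B.a_comm_group by (rule abelian_group_of_comm_group) simp_all

sublocale T: tensor_pair A "right_via B \<phi>" M
  by (intro tensor_pair.intro tensor_pair_axioms.intro abelian_group_right_via M.M.abelian_group_axioms)
    (simp_all add: M.smult_closed)

abbreviation pure (infixl \<open>\<boxtimes>\<close> 75) where
  "b \<boxtimes> m \<equiv> pure_tensor A (right_via B \<phi>) M b m"

abbreviation "X \<equiv> ext_scalars A B \<phi> M"
abbreviation "XG \<equiv> tensor_group A (right_via B \<phi>) M"

lemma mult_pure:
  "\<lbrakk>a \<in> carrier A; b \<in> carrier B; m \<in> carrier M\<rbrakk> \<Longrightarrow> (b \<otimes>\<^bsub>B\<^esub> \<phi> a) \<boxtimes> m = b \<boxtimes> (a \<odot>\<^bsub>M\<^esub> m)"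
  using T.pure_balanced[of a b m] by simp

lemma pure_add:
  "\<lbrakk>b \<in> carrier B; b' \<in> carrier B; m \<in> carrier M\<rbrakk> \<Longrightarrow> (b \<oplus>\<^bsub>B\<^esub> b') \<boxtimes> m = b \<boxtimes> m \<otimes>\<^bsub>XG\<^esub> b' \<boxtimes> m"
  "\<lbrakk>b \<in> carrier B; m \<in> carrier M; m' \<in> carrier M\<rbrakk> \<Longrightarrow> b \<boxtimes> (m \<oplus>\<^bsub>M\<^esub> m') = b \<boxtimes> m \<otimes>\<^bsub>XG\<^esub> b \<boxtimes> m'"
  using T.pure_add_left[of b b' m] T.pure_add_right[of b m m'] by simp_all

text \<open>Left multiplication by b commutes with the right action of A on B, by associativity in
  B, and so descends to the tensor product.\<close>

lemma smult_ext:
  assumes "b \<in> carrier B"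
  shows smult_pure: "\<lbrakk>b' \<in> carrier B; m \<in> carrier M\<rbrakk> \<Longrightarrow> b \<odot>\<^bsub>X\<^esub> (b' \<boxtimes> m) = (b \<otimes>\<^bsub>B\<^esub> b') \<boxtimes> m"
    and smult_hom: "(\<lambda>x. b \<odot>\<^bsub>X\<^esub> x) \<in> hom XG XG"
proof -
  have "balanced A (right_via B \<phi>) M XG (\<lambda>b' m. (b \<otimes>\<^bsub>B\<^esub> b') \<boxtimes> m)"
    using assms by (intro balancedI)
      (simp_all add: B.r_distr pure_add mult_pure B.m_assoc [symmetric])
  note lift = T.tensor_lift[OF T.comm_group_tensor this]
  have eq: "(\<lambda>x. b \<odot>\<^bsub>X\<^esub> x) = tensor_lift A (right_via B \<phi>) M XG (\<lambda>b' m. (b \<otimes>\<^bsub>B\<^esub> b') \<boxtimes> m)"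
    by (simp add: ext_scalars_def Let_def)
  show "(\<lambda>x. b \<odot>\<^bsub>X\<^esub> x) \<in> hom XG XG"
    unfolding eq by (rule lift)
  show "\<lbrakk>b' \<in> carrier B; m \<in> carrier M\<rbrakk> \<Longrightarrow> b \<odot>\<^bsub>X\<^esub> (b' \<boxtimes> m) = (b \<otimes>\<^bsub>B\<^esub> b') \<boxtimes> m"
    using lift(2) by (simp add: fun_cong[OF eq])
qed

lemmas smult_simps = smult_pure hom_mult[OF smult_hom] hom_in_carrier[OF smult_hom]

text \<open>This allows an extension to be extended again: \<open>X\<close> can take the place of M
  in another instance of the locale.\<close>

lemma left_module_ext: "left_module B X"
proof (intro left_module.intro left_module_axioms.intro)
  show "ring B" by (rule B.ring_axioms)
  show "abelian_group X"
    using T.comm_group_tensor by (rule abelian_group_of_comm_group) simp_all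
  fix a b x assume ab: "a \<in> carrier B" "b \<in> carrier B" and "x \<in> carrier X"
  then have x: "x \<in> carrier XG" by simp
  show "(a \<oplus>\<^bsub>B\<^esub> b) \<odot>\<^bsub>X\<^esub> x = a \<odot>\<^bsub>X\<^esub> x \<oplus>\<^bsub>X\<^esub> b \<odot>\<^bsub>X\<^esub> x"
    using x by (induction rule: T.tensor_induct)
      (use ab in \<open>simp_all add: smult_simps B.l_distr pure_add T.T.m_ac\<close>)
  show "(a \<otimes>\<^bsub>B\<^esub> b) \<odot>\<^bsub>X\<^esub> x = a \<odot>\<^bsub>X\<^esub> (b \<odot>\<^bsub>X\<^esub> x)"
    using x by (induction rule: T.tensor_induct) (use ab in \<open>simp_all add: smult_simps B.m_assoc\<close>)
next
  fix x assume "x \<in> carrier X"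
  then have "x \<in> carrier XG" by simp
  then show "\<one>\<^bsub>B\<^esub> \<odot>\<^bsub>X\<^esub> x = x"
    by (induction rule: T.tensor_induct) (simp_all add: smult_simps)
qed (simp_all add: smult_simps)

lemma ext_unit_closed: "m \<in> carrier M \<Longrightarrow> ext_unit A B \<phi> M m \<in> carrier XG"
  by (simp add: ext_unit_def)

lemma ext_unit_smult:
  "\<lbrakk>a \<in> carrier A; m \<in> carrier M\<rbrakk> \<Longrightarrow>
    ext_unit A B \<phi> M (a \<odot>\<^bsub>M\<^esub> m) = \<phi> a \<odot>\<^bsub>X\<^esub> ext_unit A B \<phi> M m"
  by (simp add: ext_unit_def mult_pure [symmetric] smult_pure)

text \<open>Since b \<otimes> m = b(1 \<otimes> m), the image of the natural map generates the
  extension over B.\<close>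

lemma ext_hom_eqI:
  assumes "f \<in> lmod_hom B X N" "g \<in> lmod_hom B X N"
    and eq: "\<And>m. m \<in> carrier M \<Longrightarrow> f (ext_unit A B \<phi> M m) = g (ext_unit A B \<phi> M m)"
    and "x \<in> carrier X"
  shows "f x = g x"
proof -
  have "x \<in> carrier XG" using assms(4) by simp
  then show ?thesis
  proof (induction rule: T.tensor_induct)
    case (pure b m)
    then have "b \<boxtimes> m = b \<odot>\<^bsub>X\<^esub> ext_unit A B \<phi> M m"
      by (simp add: ext_unit_def smult_pure)
    then show ?case
      using pure eq[of m] lmod_hom_smult[OF assms(1)] lmod_hom_smult[OF assms(2)]
      by (simp add: ext_unit_closed)
  qed (use lmod_hom_add[OF assms(1)] lmod_hom_add[OF assms(2)] in simp)
qed

end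

section \<open>Functoriality of extension of scalars\<close>

lemma ext_map:
  assumes "scalar_extension A B \<phi> M" "scalar_extension A B \<phi> N" and g: "g \<in> lmod_hom A M N"
  shows ext_map_pure: "\<lbrakk>b \<in> carrier B; m \<in> carrier M\<rbrakk> \<Longrightarrow>
      ext_map A B \<phi> M N g (pure_tensor A (right_via B \<phi>) M b m) = pure_tensor A (right_via B \<phi>) N b (g m)"
    and ext_map_lmod_hom: "ext_map A B \<phi> M N g \<in> lmod_hom B (ext_scalars A B \<phi> M) (ext_scalars A B \<phi> N)"
proof -
  interpret M: scalar_extension A B \<phi> M by fact
  interpret N: scalar_extension A B \<phi> N by fact
  note g' = lmod_homD[OF g]
  have "balanced A (right_via B \<phi>) M N.XG (\<lambda>b m. N.pure b (g m))"
    by (intro balancedI) (simp_all add: g' N.pure_add N.mult_pure)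
  note lift = M.T.tensor_lift[OF N.T.comm_group_tensor this, folded ext_map_def]
  show pure: "ext_map A B \<phi> M N g (M.pure b m) = N.pure b (g m)"
    if "b \<in> carrier B" "m \<in> carrier M" for b m
    using that by (intro lift) simp_all
  note hom = hom_mult[OF lift(1)] hom_in_carrier[OF lift(1)]
  show "ext_map A B \<phi> M N g \<in> lmod_hom B M.X N.X"
  proof (rule lmod_homI)
    fix b x assume b: "b \<in> carrier B" and "x \<in> carrier M.X"
    then have "x \<in> carrier M.XG" by simp
    then show "ext_map A B \<phi> M N g (b \<odot>\<^bsub>M.X\<^esub> x) = b \<odot>\<^bsub>N.X\<^esub> ext_map A B \<phi> M N g x"
      by (induction rule: M.T.tensor_induct)
        (use b in \<open>simp_all add: M.smult_simps N.smult_simps hom pure g'\<close>)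
  qed (simp_all add: hom)
qed

text \<open>A one-sided statement; exchanging the roles of f and g gives the other half of a
  bijection.\<close>

lemma ext_map_inverse:
  assumes "scalar_extension A B \<phi> M" "scalar_extension A B \<phi> N"
    and f: "f \<in> lmod_hom A M N" and g: "g \<in> lmod_hom A N M"
    and gf: "\<And>m. m \<in> carrier M \<Longrightarrow> g (f m) = m"
    and "x \<in> carrier (ext_scalars A B \<phi> M)"
  shows "ext_map A B \<phi> N M g (ext_map A B \<phi> M N f x) = x"
proof -
  interpret M: scalar_extension A B \<phi> M by fact
  note F = ext_map_pure[OF assms(1,2) f] lmod_homD[OF ext_map_lmod_hom[OF assms(1,2) f], simplified]
  note G = ext_map_pure[OF assms(2,1) g] lmod_homD[OF ext_map_lmod_hom[OF assms(2,1) g], simplified]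
  have "x \<in> carrier M.XG" using assms(6) by simp
  then show ?thesis
    by (induction rule: M.T.tensor_induct) (simp_all add: F G gf lmod_hom_closed[OF f])
qed

section \<open>Double extensions along two factorisations of one map from A to C\<close>

locale extension_square =
  \<phi>: scalar_extension A B \<phi> M + \<phi>': scalar_extension A B' \<phi>' M + C: ring C
  for A :: "('a, 'x) ring_scheme" and B :: "('b, 'y) ring_scheme" and B' :: "('b2, 'y2) ring_scheme"
    and C :: "('c, 'w) ring_scheme" and \<phi> \<psi> \<phi>' \<psi>' and M :: "('a, 'm, 'z) module_scheme" +
  assumes \<psi>: "\<psi> \<in> ring_hom B C" and \<psi>': "\<psi>' \<in> ring_hom B' C"
    and commute: "a \<in> carrier A \<Longrightarrow> \<psi> (\<phi> a) = \<psi>' (\<phi>' a)"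
begin

sublocale \<psi>: scalar_extension B C \<psi> "ext_scalars A B \<phi> M"
  by (intro scalar_extension.intro scalar_extension_axioms.intro C.ring_axioms \<phi>.left_module_ext \<psi>)

sublocale \<psi>': scalar_extension B' C \<psi>' "ext_scalars A B' \<phi>' M"
  by (intro scalar_extension.intro scalar_extension_axioms.intro C.ring_axioms \<phi>'.left_module_ext \<psi>')

text \<open>The formula is forced by C-linearity and compatibility with the natural maps: b acts on
  the generator through \<psi>, so it joins c and leaves the unit of B' behind.\<close>

lemma shift_exists:
  obtains g where "g \<in> lmod_hom C \<psi>.X \<psi>'.X"
    "\<And>c b m. \<lbrakk>c \<in> carrier C; b \<in> carrier B; m \<in> carrier M\<rbrakk> \<Longrightarrow>
      g (\<psi>.pure c (\<phi>.pure b m)) = \<psi>'.pure (c \<otimes>\<^bsub>C\<^esub> \<psi> b) (\<phi>'.pure \<one>\<^bsub>B'\<^esub> m)"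
proof -
  let ?f = "\<lambda>c b m. \<psi>'.pure (c \<otimes>\<^bsub>C\<^esub> \<psi> b) (\<phi>'.pure \<one>\<^bsub>B'\<^esub> m)"
  let ?i = "\<lambda>c. tensor_lift A (right_via B \<phi>) M \<psi>'.XG (?f c)"
  have bal: "balanced A (right_via B \<phi>) M \<psi>'.XG (?f c)" if c: "c \<in> carrier C" for c
  proof (rule balancedI)
    fix a b m assume abm: "a \<in> carrier A" "b \<in> carrier (right_via B \<phi>)" "m \<in> carrier M"
    \<comment> \<open>Here commutation of the square is used: the image of a in C is also
      \<open>\<psi>' (\<phi>' a)\<close>, and in this form it can cross the tensor sign over B' and
      then reach m.\<close>
    have "c \<otimes>\<^bsub>C\<^esub> \<psi> (b \<otimes>\<^bsub>B\<^esub> \<phi> a) = (c \<otimes>\<^bsub>C\<^esub> \<psi> b) \<otimes>\<^bsub>C\<^esub> \<psi>' (\<phi>' a)"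
      using abm c by (simp add: commute C.m_assoc)
    moreover have "\<phi>' a \<odot>\<^bsub>\<phi>'.X\<^esub> \<phi>'.pure \<one>\<^bsub>B'\<^esub> m = \<phi>'.pure \<one>\<^bsub>B'\<^esub> (a \<odot>\<^bsub>M\<^esub> m)"
      using abm \<phi>'.ext_unit_smult[of a m] by (simp add: ext_unit_def)
    ultimately show "?f c (a \<odot>\<^bsub>right_via B \<phi>\<^esub> b) m = ?f c b (a \<odot>\<^bsub>M\<^esub> m)"
      using abm c by (simp add: \<psi>'.mult_pure)
  qed (use c in \<open>simp_all add: C.r_distr \<psi>'.pure_add \<phi>'.pure_add \<psi>'.pure_add(2)[simplified]\<close>)
  note lift = \<phi>.T.tensor_lift[OF \<psi>'.T.comm_group_tensor bal, simplified]
  note i = hom_mult[OF lift(1)] hom_in_carrier[OF lift(1)] lift(2)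
  have bal2: "balanced B (right_via C \<psi>) \<phi>.X \<psi>'.XG ?i"
  proof (rule balancedI)
    show "?i (c \<oplus>\<^bsub>right_via C \<psi>\<^esub> c') x = ?i c x \<otimes>\<^bsub>\<psi>'.XG\<^esub> ?i c' x"
      if "c \<in> carrier (right_via C \<psi>)" "c' \<in> carrier (right_via C \<psi>)" "x \<in> carrier \<phi>.X" for c c' x
    proof -
      have "x \<in> carrier \<phi>.XG" using that by simp
      then show ?thesis
        by (induction rule: \<phi>.T.tensor_induct)
          (use that in \<open>simp_all add: i C.l_distr \<psi>'.pure_add \<psi>'.T.T.m_ac\<close>)
    qed
    \<comment> \<open>On a pure x this is multiplicativity of \<psi> together with associativity in
      C.\<close>
    show "?i (b \<odot>\<^bsub>right_via C \<psi>\<^esub> c) x = ?i c (b \<odot>\<^bsub>\<phi>.X\<^esub> x)"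
      if "b \<in> carrier B" "c \<in> carrier (right_via C \<psi>)" "x \<in> carrier \<phi>.X" for b c x
    proof -
      have "x \<in> carrier \<phi>.XG" using that by simp
      then show ?thesis
        by (induction rule: \<phi>.T.tensor_induct)
          (use that in \<open>simp_all add: i C.m_assoc \<phi>.smult_simps\<close>)
    qed
  qed (simp_all add: i)
  let ?g = "tensor_lift B (right_via C \<psi>) \<phi>.X \<psi>'.XG ?i"
  note lift2 = \<psi>.T.tensor_lift[OF \<psi>'.T.comm_group_tensor bal2, simplified]
  note g = hom_mult[OF lift2(1)] hom_in_carrier[OF lift2(1)] lift2(2)
  show thesis
  proof (rule that)
    show "?g \<in> lmod_hom C \<psi>.X \<psi>'.X"
    proof (rule lmod_homI)
      fix c x assume c: "c \<in> carrier C" and "x \<in> carrier \<psi>.X"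
      then have "x \<in> carrier \<psi>.XG" by simp
      then show "?g (c \<odot>\<^bsub>\<psi>.X\<^esub> x) = c \<odot>\<^bsub>\<psi>'.X\<^esub> ?g x"
      proof (induction rule: \<psi>.T.tensor_induct)
        case p: (pure c' y)
        then have "y \<in> carrier \<phi>.XG" by simp
        then have "?i (c \<otimes>\<^bsub>C\<^esub> c') y = c \<odot>\<^bsub>\<psi>'.X\<^esub> ?i c' y"
          by (induction rule: \<phi>.T.tensor_induct)
            (use p c in \<open>simp_all add: i \<psi>'.smult_simps C.m_assoc\<close>)
        then show ?case using p c by (simp add: g \<psi>.smult_simps)
      qed (use c in \<open>simp_all add: g \<psi>.smult_simps \<psi>'.smult_simps\<close>)
    qed (simp_all add: g)
  qed (simp add: g i)
qed

end

text \<open>The mirrored square yields the identification in the opposite direction, so each fact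
  about squares serves both ways.\<close>

lemma extension_square_sym:
  "extension_square A B B' C \<phi> \<psi> \<phi>' \<psi>' M \<Longrightarrow> extension_square A B' B C \<phi>' \<psi>' \<phi> \<psi> M"
  by (simp add: extension_square_def extension_square_axioms_def)

context extension_square
begin

text \<open>The elements 1 \<otimes> (1 \<otimes> m) generate the double extension over C, because c
  \<otimes> (b \<otimes> m) is their multiple by \<open>c \<psi>(b)\<close>.\<close>

lemma unit_generates:
  assumes "f \<in> lmod_hom C \<psi>.X N" "g \<in> lmod_hom C \<psi>.X N"
    and "\<And>m. m \<in> carrier M \<Longrightarrow> f (ext_unit B C \<psi> \<phi>.X (ext_unit A B \<phi> M m)) = g (ext_unit B C \<psi> \<phi>.X (ext_unit A B \<phi> M m))"
    and "x \<in> carrier \<psi>.X"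
  shows "f x = g x"
proof (rule \<psi>.ext_hom_eqI[OF assms(1,2) _ assms(4)])
  fix y assume "y \<in> carrier \<phi>.X"
  then have "y \<in> carrier \<phi>.XG" by simp
  then show "f (ext_unit B C \<psi> \<phi>.X y) = g (ext_unit B C \<psi> \<phi>.X y)"
  proof (induction rule: \<phi>.T.tensor_induct)
    case (pure b m)
    let ?u = "ext_unit B C \<psi> \<phi>.X (ext_unit A B \<phi> M m)"
    have "\<phi>.pure b m = b \<odot>\<^bsub>\<phi>.X\<^esub> ext_unit A B \<phi> M m"
      using pure by (simp add: ext_unit_def \<phi>.smult_pure)
    then have "ext_unit B C \<psi> \<phi>.X (\<phi>.pure b m) = \<psi> b \<odot>\<^bsub>\<psi>.X\<^esub> ?u"
      using pure \<psi>.ext_unit_smult[of b "ext_unit A B \<phi> M m"] by (simp add: \<phi>.ext_unit_closed)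
    moreover have "?u \<in> carrier \<psi>.X"
      using pure \<psi>.ext_unit_closed \<phi>.ext_unit_closed by simp
    ultimately show ?case
      using pure assms(3) lmod_hom_smult[OF assms(1)] lmod_hom_smult[OF assms(2)] by simp
  next
    case (add x y)
    have "ext_unit B C \<psi> \<phi>.X (x \<otimes>\<^bsub>\<phi>.XG\<^esub> y) = ext_unit B C \<psi> \<phi>.X x \<otimes>\<^bsub>\<psi>.XG\<^esub> ext_unit B C \<psi> \<phi>.X y"
      using add \<psi>.pure_add(2)[of "\<one>\<^bsub>C\<^esub>" x y] by (simp add: ext_unit_def)
    then show ?case
      using add lmod_hom_add[OF assms(1)] lmod_hom_add[OF assms(2)] \<psi>.ext_unit_closed by simp
  qed
qed

text \<open>Discharges the \<open>THE\<close>. The shift maps of the square and of its mirror image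
  are mutually inverse, as both composites fix the generators 1 \<otimes> (1 \<otimes> m); the same
  generators give uniqueness.\<close>

lemma ext_ident:
  shows ext_ident_iso: "ext_ident A B B' C \<phi> \<psi> \<phi>' \<psi>' M \<in> lmod_iso C \<psi>.X \<psi>'.X"
    and ext_ident_pure: "\<lbrakk>c \<in> carrier C; b \<in> carrier B; m \<in> carrier M\<rbrakk> \<Longrightarrow>
      ext_ident A B B' C \<phi> \<psi> \<phi>' \<psi>' M (\<psi>.pure c (\<phi>.pure b m)) =
        \<psi>'.pure (c \<otimes>\<^bsub>C\<^esub> \<psi> b) (\<phi>'.pure \<one>\<^bsub>B'\<^esub> m)"
proof -
  interpret sym: extension_square A B' B C \<phi>' \<psi>' \<phi> \<psi> M
    by (rule extension_square_sym) (rule extension_square_axioms)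
  obtain g where g: "g \<in> lmod_hom C \<psi>.X \<psi>'.X"
    and g_pure: "\<And>c b m. \<lbrakk>c \<in> carrier C; b \<in> carrier B; m \<in> carrier M\<rbrakk> \<Longrightarrow>
      g (\<psi>.pure c (\<phi>.pure b m)) = \<psi>'.pure (c \<otimes>\<^bsub>C\<^esub> \<psi> b) (\<phi>'.pure \<one>\<^bsub>B'\<^esub> m)"
    using shift_exists by blast
  obtain h where h: "h \<in> lmod_hom C \<psi>'.X \<psi>.X"
    and h_pure: "\<And>c b m. \<lbrakk>c \<in> carrier C; b \<in> carrier B'; m \<in> carrier M\<rbrakk> \<Longrightarrow>
      h (\<psi>'.pure c (\<phi>'.pure b m)) = \<psi>.pure (c \<otimes>\<^bsub>C\<^esub> \<psi>' b) (\<phi>.pure \<one>\<^bsub>B\<^esub> m)"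
    using sym.shift_exists by blast
  have hg: "h (g x) = x" if "x \<in> carrier \<psi>.X" for x
    using unit_generates[OF lmod_hom_comp[OF g h] lmod_hom_id _ that]
    by (simp add: ext_unit_def g_pure h_pure)
  have gh: "g (h x) = x" if "x \<in> carrier \<psi>'.X" for x
    using sym.unit_generates[OF lmod_hom_comp[OF h g] lmod_hom_id _ that]
    by (simp add: ext_unit_def g_pure h_pure)
  let ?P = "\<lambda>g. g \<in> lmod_iso C \<psi>.X \<psi>'.X \<and> g \<in> extensional (carrier \<psi>.X) \<and>
       (\<forall>m\<in>carrier M. g (ext_unit B C \<psi> \<phi>.X (ext_unit A B \<phi> M m)) =
         ext_unit B' C \<psi>' \<phi>'.X (ext_unit A B' \<phi>' M m))"
  \<comment> \<open>Cutting the map off outside the carrier makes it extensional, which the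
    \<open>THE\<close> requires.\<close>
  let ?r = "restrict g (carrier \<psi>.X)"
  interpret X: left_module C \<psi>.X by (rule \<psi>.left_module_ext)
  have r: "?r \<in> lmod_hom C \<psi>.X \<psi>'.X"
    using g X.M.a_closed X.smult_closed by (auto simp: lmod_hom_def simp del: ext_scalars_simps)
  have "?r \<in> lmod_iso C \<psi>.X \<psi>'.X"
    by (rule lmod_isoI[OF r, of h]) (use lmod_hom_closed[OF h] hg gh in auto)
  then have r_prop: "?P ?r"
    using \<psi>.ext_unit_closed \<phi>.ext_unit_closed by (simp add: g_pure ext_unit_def)
  have "k = ?r" if "?P k" for k
  proof
    fix x
    have k: "k \<in> lmod_hom C \<psi>.X \<psi>'.X"
      using that by (simp add: lmod_iso_def)
    show "k x = ?r x"
    proof (cases "x \<in> carrier \<psi>.X")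
      case True
      show ?thesis
      proof (rule unit_generates[OF k r _ True])
        fix m assume m: "m \<in> carrier M"
        show "k (ext_unit B C \<psi> \<phi>.X (ext_unit A B \<phi> M m)) =
            ?r (ext_unit B C \<psi> \<phi>.X (ext_unit A B \<phi> M m))"
          using bspec[OF conjunct2[OF conjunct2[OF that]] m] bspec[OF conjunct2[OF conjunct2[OF r_prop]] m]
          by (simp only:)
      qed
    next
      case False
      then show ?thesis using that by (auto simp: extensional_def)
    qed
  qed
  with r_prop have eq: "ext_ident A B B' C \<phi> \<psi> \<phi>' \<psi>' M = ?r"
    unfolding ext_ident_def Let_def by (rule the_equality)
  show "ext_ident A B B' C \<phi> \<psi> \<phi>' \<psi>' M \<in> lmod_iso C \<psi>.X \<psi>'.X"
    unfolding eq by fact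
  show "\<lbrakk>c \<in> carrier C; b \<in> carrier B; m \<in> carrier M\<rbrakk> \<Longrightarrow>
      ext_ident A B B' C \<phi> \<psi> \<phi>' \<psi>' M (\<psi>.pure c (\<phi>.pure b m)) =
        \<psi>'.pure (c \<otimes>\<^bsub>C\<^esub> \<psi> b) (\<phi>'.pure \<one>\<^bsub>B'\<^esub> m)"
    unfolding eq by (simp add: g_pure)
qed

lemma ext_ident_lmod_hom: "ext_ident A B B' C \<phi> \<psi> \<phi>' \<psi>' M \<in> lmod_hom C \<psi>.X \<psi>'.X"
  using ext_ident_iso by (simp add: lmod_iso_def)

lemma ext_ident_inverse:
  assumes "x \<in> carrier \<psi>.X"
  shows "ext_ident A B' B C \<phi>' \<psi>' \<phi> \<psi> M (ext_ident A B B' C \<phi> \<psi> \<phi>' \<psi>' M x) = x"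
proof -
  interpret sym: extension_square A B' B C \<phi>' \<psi>' \<phi> \<psi> M
    by (rule extension_square_sym) (rule extension_square_axioms)
  show ?thesis
    using unit_generates[OF lmod_hom_comp[OF ext_ident_lmod_hom sym.ext_ident_lmod_hom] lmod_hom_id _ assms]
    by (simp add: ext_unit_def ext_ident_pure sym.ext_ident_pure)
qed

end

section \<open>Identifying the extension along \<eta> \<otimes> id with H \<otimes> M\<close>

lemma lmod_hom_base_restrict:
  assumes "assoc_algebra K A" "f \<in> lmod_hom A M N"
  shows "f \<in> lmod_hom K (base_restrict A M) (base_restrict A N)"
proof -
  interpret A: assoc_algebra K A by fact
  show ?thesis
    by (rule lmod_homI) (simp_all add: lmod_homD[OF assms(2)])
qed

text \<open>Kept general in A and M because it is instantiated twice: for M over A, and for the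
  extension of M along \<eta> \<otimes> id over H \<otimes> A. \<open>HV\<close> and
  \<open>HM\<close> share their carrier; the first is the K-module, the second the module over H
  \<otimes> A.\<close>

locale tensor_scalars = H: assoc_algebra K H + A: assoc_algebra K A + M: left_module A M
  for K :: "('k, 'x) ring_scheme" and H :: "('k, 'h, 'y) module_scheme"
    and A :: "('k, 'a, 'z) module_scheme" and M :: "('a, 'm, 'w) module_scheme"
begin

abbreviation "HA \<equiv> tensor_alg K H A"
abbreviation "V \<equiv> base_restrict A M"
abbreviation "HV \<equiv> tensor_alg K H V"
abbreviation "HM \<equiv> tensor_mod K H A M"
abbreviation "I \<equiv> ext_unit_tensor_ident K H A M"

lemmas algebras = H.assoc_algebra_axioms A.assoc_algebra_axioms
lemmas modules = algebras[THEN assoc_algebra_module]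
  module_base_restrict[OF A.assoc_algebra_axioms M.left_module_axioms]

sublocale HA: assoc_algebra K HA
  using algebras by (rule assoc_algebra_tensor_alg)

sublocale THA: tensor_pair K H A
  using modules by (intro module_tensor_pair)

sublocale THV: tensor_pair K H V
  using modules by (intro module_tensor_pair)

sublocale E: scalar_extension A HA "unit_tensor K H A" M
  by (intro scalar_extension.intro scalar_extension_axioms.intro HA.A.ring_axioms M.left_module_axioms
      alg_hom_imp_ring_hom[OF unit_tensor_alg_hom] algebras)

text \<open>Well defined because (h \<otimes> a)(1 \<otimes> a') = h \<otimes> aa' and (aa')m =
  a(a'm), which is balancedness over A.\<close>

lemma I_hom: "I \<in> hom E.XG (tensor_group K H V)"
  and I_pure: "\<lbrakk>h \<in> carrier H; a \<in> carrier A; m \<in> carrier M\<rbrakk> \<Longrightarrow>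
    I (E.pure (pure_tensor K H A h a) m) = pure_tensor K H V h (a \<odot>\<^bsub>M\<^esub> m)"
proof -
  let ?T = "tensor_group K H V"
  let ?i = "\<lambda>m. tensor_lift K H A ?T (\<lambda>h a. pure_tensor K H V h (a \<odot>\<^bsub>M\<^esub> m))"
  note act = bilinearD[OF bilinear_smult[OF A.assoc_algebra_axioms M.left_module_axioms], simplified]
  have bal: "balanced K H A ?T (\<lambda>h a. pure_tensor K H V h (a \<odot>\<^bsub>M\<^esub> m))" if "m \<in> carrier M" for m
    using that by (intro balancedI)
      (simp_all add: act THV.pure_add_left THV.pure_add_right[simplified] THV.pure_balanced[simplified])
  note lift = THA.tensor_lift[OF THV.comm_group_tensor bal]
  note i = hom_mult[OF lift(1)] hom_in_carrier[OF lift(1)] lift(2)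
  have bal2: "balanced A (right_via HA (unit_tensor K H A)) M ?T (\<lambda>x m. ?i m x)"
  proof (rule balancedI)
    show "?i (m \<oplus>\<^bsub>M\<^esub> m') x = ?i m x \<otimes>\<^bsub>?T\<^esub> ?i m' x"
      if "x \<in> carrier (right_via HA (unit_tensor K H A))" "m \<in> carrier M" "m' \<in> carrier M" for x m m'
    proof -
      have "x \<in> carrier (tensor_group K H A)" using that by simp
      then show ?thesis
        by (induction rule: THA.tensor_induct)
          (use that in \<open>simp_all add: i act THV.pure_add_right[simplified] THV.T.m_ac\<close>)
    qed
    show "?i m (a \<odot>\<^bsub>right_via HA (unit_tensor K H A)\<^esub> x) = ?i (a \<odot>\<^bsub>M\<^esub> m) x"
      if "a \<in> carrier A" "x \<in> carrier (right_via HA (unit_tensor K H A))" "m \<in> carrier M" for a x m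
    proof -
      have "x \<in> carrier (tensor_group K H A)" using that by simp
      then show ?thesis
        by (induction rule: THA.tensor_induct)
          (use that in \<open>simp_all add: i act unit_tensor_def assoc_algebra_tensor_mult[OF algebras] M.smult_assoc\<close>)
    qed
  qed (simp_all add: i)
  have eq: "I = tensor_lift A (right_via HA (unit_tensor K H A)) M ?T (\<lambda>x m. ?i m x)"
    by (simp add: ext_unit_tensor_ident_def Let_def)
  note lift2 = E.T.tensor_lift[OF THV.comm_group_tensor bal2, folded eq]
  show "I \<in> hom E.XG ?T" by (rule lift2)
  show "I (E.pure (pure_tensor K H A h a) m) = pure_tensor K H V h (a \<odot>\<^bsub>M\<^esub> m)"
    if "h \<in> carrier H" "a \<in> carrier A" "m \<in> carrier M"
    using that by (simp add: lift2(2) i)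
qed

lemma E_induct [consumes 1, case_names pure add]:
  assumes "x \<in> carrier E.X"
    and pure: "\<And>h a m. \<lbrakk>h \<in> carrier H; a \<in> carrier A; m \<in> carrier M\<rbrakk> \<Longrightarrow> P (E.pure (pure_tensor K H A h a) m)"
    and add: "\<And>x y. \<lbrakk>x \<in> carrier E.XG; y \<in> carrier E.XG; P x; P y\<rbrakk> \<Longrightarrow> P (x \<otimes>\<^bsub>E.XG\<^esub> y)"
  shows "P x"
proof -
  have "x \<in> carrier E.XG" using assms(1) by simp
  then show ?thesis
  proof (induction rule: E.T.tensor_induct)
    case p: (pure y m)
    then have "y \<in> carrier (tensor_group K H A)" by simp
    then show ?case
    proof (induction rule: THA.tensor_induct)
      case (add x y)
      then show ?case using p assms(3)[of "E.pure x m" "E.pure y m"] E.pure_add(1)[of x y m] by simp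
    qed (use p pure in simp)
  qed (rule add)
qed

lemma I_lmod_hom: "I \<in> lmod_hom HA E.X HM"
proof (rule lmod_homI)
  note act = tensor_action[OF modules(1,2,1,3,1,3) assoc_algebra_bilinear_mult[OF algebras(1)]
      bilinear_smult[OF A.assoc_algebra_axioms M.left_module_axioms], folded tensor_mod_smult]
  note act' = act(1)[simplified] hom_mult[OF act(2)] hom_in_carrier[OF act(2)]
    hom_mult[OF act(3)] hom_in_carrier[OF act(3)]
  note I = hom_mult[OF I_hom] hom_in_carrier[OF I_hom] I_pure
  note m = assoc_algebra_tensor_mult[OF algebras]
  fix y x assume "y \<in> carrier HA" and x: "x \<in> carrier E.X"
  then have y: "y \<in> carrier (tensor_group K H A)" by simp
  from x show "I (y \<odot>\<^bsub>E.X\<^esub> x) = y \<odot>\<^bsub>HM\<^esub> I x"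
  proof (induction rule: E_induct)
    case (pure h a m)
    from y show ?case
      by (induction rule: THA.tensor_induct)
        (use pure in \<open>simp_all add: E.smult_simps m I act' M.smult_assoc M.smult_closed E.pure_add[simplified]\<close>)
  qed (use y in \<open>simp_all add: E.smult_simps I act'\<close>)
qed (simp_all add: hom_mult[OF I_hom] hom_in_carrier[OF I_hom])

text \<open>Prepares \<open>I\<close> for use inside \<open>tensor_map\<close>, as the right factor
  of id \<otimes> \<open>I\<close>.\<close>

lemma I_lmod_hom_base: "I \<in> lmod_hom K (base_restrict HA E.X) HV"
  using lmod_homD[OF I_lmod_hom]
  by (intro lmod_homI)
    (simp_all add: tensor_mod_smult_one[OF algebras M.left_module_axioms, simplified]
      HA.smult_closed[simplified])

text \<open>The inverse inserts the unit of A. It is provided as a K-linear map because it, too, is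
  tensored with the identity of H later.\<close>

lemma I_inverse:
  obtains J where "J \<in> lmod_hom K HV (base_restrict HA E.X)"
    "\<And>h m. \<lbrakk>h \<in> carrier H; m \<in> carrier M\<rbrakk> \<Longrightarrow> J (pure_tensor K H V h m) = E.pure (pure_tensor K H A h \<one>\<^bsub>A\<^esub>) m"
    "\<And>x. x \<in> carrier E.X \<Longrightarrow> J (I x) = x"
    "\<And>t. t \<in> carrier HV \<Longrightarrow> I (J t) = t"
proof -
  let ?f = "\<lambda>h m. E.pure (pure_tensor K H A h \<one>\<^bsub>A\<^esub>) m"
  let ?J = "tensor_lift K H V E.XG ?f"
  note m = assoc_algebra_tensor_mult[OF algebras]
  \<comment> \<open>Writing h \<otimes> a as (h \<otimes> 1)(1 \<otimes> a) lets a cross over to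
    m.\<close>
  have slide: "E.pure (pure_tensor K H A h a) m = ?f h (a \<odot>\<^bsub>M\<^esub> m)"
    if "h \<in> carrier H" "a \<in> carrier A" "m \<in> carrier M" for h a m
    using E.mult_pure[of a "pure_tensor K H A h \<one>\<^bsub>A\<^esub>" m] that by (simp add: unit_tensor_def m)
  have "balanced K H V E.XG ?f"
  proof (rule balancedI)
    fix k h m assume khm: "k \<in> carrier K" "h \<in> carrier H" "m \<in> carrier V"
    \<comment> \<open>The scalar passes from h to the unit of A, becoming k1, and
      \<open>slide\<close> relates this to the action of k1 on m.\<close>
    have "pure_tensor K H A (k \<odot>\<^bsub>H\<^esub> h) \<one>\<^bsub>A\<^esub> = pure_tensor K H A h (k \<odot>\<^bsub>A\<^esub> \<one>\<^bsub>A\<^esub>)"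
      using khm by (simp add: THA.pure_balanced)
    then show "?f (k \<odot>\<^bsub>H\<^esub> h) m = ?f h (k \<odot>\<^bsub>V\<^esub> m)"
      using khm by (simp add: slide [symmetric])
  qed (simp_all add: THA.pure_add_left E.pure_add[simplified] E.pure_add)
  note J = E.T.comm_group_tensor[THEN THV.tensor_lift_hom, OF this]
    E.T.comm_group_tensor[THEN THV.tensor_lift_pure, OF this, simplified]
  note I = hom_mult[OF I_hom] hom_in_carrier[OF I_hom] I_pure
  note J' = hom_mult[OF J(1)] hom_in_carrier[OF J(1)] J(2)
  have JI: "?J (I x) = x" if "x \<in> carrier E.X" for x
    using that by (induction rule: E_induct) (simp_all add: I J' slide [symmetric] M.smult_closed)
  have IJ: "I (?J t) = t" if "t \<in> carrier HV" for t
  proof -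
    have "t \<in> carrier (tensor_group K H V)" using that by simp
    then show ?thesis
      by (induction rule: THV.tensor_induct) (simp_all add: I J' M.smult_one)
  qed
  interpret HV: module K HV
    using modules(1,3) by (rule module_tensor_alg)
  interpret EX: module K "base_restrict HA E.X"
    by (rule module_base_restrict[OF HA.assoc_algebra_axioms E.left_module_ext])
  have "?J \<in> lmod_hom K HV (base_restrict HA E.X)"
  proof (rule lmod_homI)
    fix k t assume kt: "k \<in> carrier K" "t \<in> carrier HV"
    have Jt: "?J t \<in> carrier (base_restrict HA E.X)" using kt by (simp add: J')
    \<comment> \<open>Linearity of the inverse is inherited from \<open>I\<close>: the image under
      \<open>I\<close> is computed here, and \<open>?J\<close> undoes \<open>I\<close>.\<close>
    have "I (k \<odot>\<^bsub>base_restrict HA E.X\<^esub> ?J t) = k \<odot>\<^bsub>HV\<^esub> t"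
      using lmod_hom_smult[OF I_lmod_hom_base kt(1) Jt] IJ[OF kt(2)] by (simp only:)
    then show "?J (k \<odot>\<^bsub>HV\<^esub> t) = k \<odot>\<^bsub>base_restrict HA E.X\<^esub> ?J t"
      using JI[of "k \<odot>\<^bsub>base_restrict HA E.X\<^esub> ?J t"] EX.smult_closed[OF kt(1) Jt] by simp
  qed (simp_all add: J')
  with J'(3) JI IJ show thesis by (intro that[of ?J]) simp_all
qed

lemma I_lmod_iso: "I \<in> lmod_iso HA E.X HM"
proof -
  obtain J where J: "J \<in> lmod_hom K HV (base_restrict HA E.X)"
    "\<And>x. x \<in> carrier E.X \<Longrightarrow> J (I x) = x" "\<And>t. t \<in> carrier HV \<Longrightarrow> I (J t) = t"
    using I_inverse by metis
  show ?thesis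
    using lmod_hom_closed[OF J(1)] J(2,3) by (intro lmod_isoI[OF I_lmod_hom, of J]) auto
qed

end

subsection \<open>Invertible structure maps\<close>

text \<open>If f = g on S, then f maps g'(y) to y, and applying f' gives g'(y) = f'(y). The converse
  is the same argument with the two sides exchanged.\<close>

lemma inverses_agree_iff:
  assumes "\<And>x. x \<in> S \<Longrightarrow> f x \<in> T" "\<And>x. x \<in> S \<Longrightarrow> g x \<in> T"
    and "\<And>y. y \<in> T \<Longrightarrow> f' y \<in> S" "\<And>y. y \<in> T \<Longrightarrow> g' y \<in> S"
    and "\<And>x. x \<in> S \<Longrightarrow> f' (f x) = x" "\<And>x. x \<in> S \<Longrightarrow> g' (g x) = x"
    and "\<And>y. y \<in> T \<Longrightarrow> f (f' y) = y" "\<And>y. y \<in> T \<Longrightarrow> g (g' y) = y"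
  shows "(\<forall>x\<in>S. f x = g x) \<longleftrightarrow> (\<forall>y\<in>T. f' y = g' y)"
  using assms by metis

section \<open>The squares behind the cocycle condition\<close>

locale coaction_iso = left_coaction K H \<Delta> \<epsilon> A \<delta> + M: left_module A M
  for K :: "('k, 'x) ring_scheme" and H :: "('k, 'h, 'y) module_scheme"
    and \<Delta> \<epsilon> and A :: "('k, 'a, 'z) module_scheme" and \<delta>
    and M :: "('a, 'm, 'w) module_scheme" +
  fixes \<Theta> :: "('h, 'm) tensor \<Rightarrow> (('h, 'a) tensor, 'm) tensor"
  assumes \<Theta>: "\<Theta> \<in> lmod_iso (tensor_alg K H A) (tensor_mod K H A M)
      (ext_scalars A (tensor_alg K H A) \<delta> M)"
begin

sublocale X: tensor_scalars K H A M
  by (intro tensor_scalars.intro assoc_algebra_axioms A.assoc_algebra_axioms M.left_module_axioms)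

text \<open>\<open>XX.E.X\<close> is the double extension of M along \<eta> \<otimes> id, the source
  of both sides of the cocycle equation; \<open>XX.I\<close> identifies it with the tensor product
  of H and the single extension.\<close>

sublocale XX: tensor_scalars K H X.HA X.E.X
  by (intro tensor_scalars.intro assoc_algebra_axioms X.HA.assoc_algebra_axioms X.E.left_module_ext)

abbreviation "HHA \<equiv> tensor_alg K H X.HA"
abbreviation "\<eta>_A \<equiv> unit_tensor K H A"
abbreviation "\<eta>_HA \<equiv> unit_tensor K H X.HA"
abbreviation "\<Delta>_A \<equiv> comult_tensor K H \<Delta> A"
abbreviation "id_\<delta> \<equiv> tensor_map K H A H X.HA id \<delta>"

sublocale Y: scalar_extension A X.HA \<delta> M
  by (intro scalar_extension.intro scalar_extension_axioms.intro X.HA.A.ring_axioms M.left_module_axioms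
      alg_hom_imp_ring_hom[OF coaction_hom])

lemma id_\<delta>_alg_hom: "id_\<delta> \<in> alg_hom K X.HA HHA"
  by (intro tensor_map_alg_hom X.algebras XX.algebras alg_hom_id coaction_hom)

lemma \<Delta>_A_alg_hom: "\<Delta>_A \<in> alg_hom K X.HA HHA"
  by (intro comult_tensor_alg_hom X.algebras comult_hom)

lemma id_\<delta>_pure:
  "\<lbrakk>h \<in> carrier H; a \<in> carrier A\<rbrakk> \<Longrightarrow> id_\<delta> (pure_tensor K H A h a) = pure_tensor K H X.HA h (\<delta> a)"
  by (simp add: tensor_map_pure X.modules XX.modules lmod_hom_id alg_hom_imp_lmod_hom[OF coaction_hom])

lemma \<Delta>_A_pure:
  "\<lbrakk>h \<in> carrier H; a \<in> carrier A\<rbrakk> \<Longrightarrow>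
    \<Delta>_A (pure_tensor K H A h a) = tensor_assoc K H H A (pure_tensor K (tensor_alg K H H) A (\<Delta> h) a)"
  by (simp add: comult_tensor_pure X.modules alg_hom_imp_lmod_hom[OF comult_hom])

lemma \<Delta>_one: "\<Delta> \<one>\<^bsub>H\<^esub> = pure_tensor K H H \<one>\<^bsub>H\<^esub> \<one>\<^bsub>H\<^esub>"
  using ring_hom_one[OF alg_hom_imp_ring_hom[OF comult_hom]] by simp

text \<open>Both composites send a to 1 \<otimes> \<delta>(a). This square links the first
  application of \<Theta> in the cocycle equation to the second.\<close>

sublocale S1: extension_square A X.HA X.HA HHA \<delta> \<eta>_HA \<eta>_A id_\<delta> M
proof (intro extension_square.intro extension_square_axioms.intro)
  show "\<eta>_HA (\<delta> a) = id_\<delta> (\<eta>_A a)" if "a \<in> carrier A" for a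
    using that by (simp add: unit_tensor_def id_\<delta>_pure)
qed (rule Y.scalar_extension_axioms X.E.scalar_extension_axioms XX.HA.A.ring_axioms
    XX.E.\<phi> alg_hom_imp_ring_hom[OF id_\<delta>_alg_hom])+

text \<open>Commutes by coassociativity of \<delta>; the associator is part of
  \<open>comult_tensor\<close>. It joins the targets of the two sides.\<close>

sublocale S2: extension_square A X.HA X.HA HHA \<delta> id_\<delta> \<delta> \<Delta>_A M
proof (intro extension_square.intro extension_square_axioms.intro)
  show "id_\<delta> (\<delta> a) = \<Delta>_A (\<delta> a)" if "a \<in> carrier A" for a
    using coaction_coassoc[OF that] by (simp add: comult_tensor_def)
qed (rule Y.scalar_extension_axioms XX.HA.A.ring_axioms
    alg_hom_imp_ring_hom[OF id_\<delta>_alg_hom] alg_hom_imp_ring_hom[OF \<Delta>_A_alg_hom])+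

text \<open>Both composites send a to 1 \<otimes> (1 \<otimes> a), since \<Delta> preserves the
  unit. It joins the sources of the two sides.\<close>

sublocale S3: extension_square A X.HA X.HA HHA \<eta>_A \<eta>_HA \<eta>_A \<Delta>_A M
proof (intro extension_square.intro extension_square_axioms.intro)
  show "\<eta>_HA (\<eta>_A a) = \<Delta>_A (\<eta>_A a)" if "a \<in> carrier A" for a
    using that by (simp add: unit_tensor_def \<Delta>_A_pure \<Delta>_one tensor_assoc_pure X.modules)
qed (rule X.E.scalar_extension_axioms XX.HA.A.ring_axioms XX.E.\<phi> alg_hom_imp_ring_hom[OF \<Delta>_A_alg_hom])+

text \<open>This and the next two are the mirrored squares, whose identifications appear in the
  inverted cocycle equation.\<close>

sublocale S1': extension_square A X.HA X.HA HHA \<eta>_A id_\<delta> \<delta> \<eta>_HA M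
  by (rule extension_square_sym) (rule S1.extension_square_axioms)

sublocale S2': extension_square A X.HA X.HA HHA \<delta> \<Delta>_A \<delta> id_\<delta> M
  by (rule extension_square_sym) (rule S2.extension_square_axioms)

sublocale S3': extension_square A X.HA X.HA HHA \<eta>_A \<Delta>_A \<eta>_A \<eta>_HA M
  by (rule extension_square_sym) (rule S3.extension_square_axioms)

section \<open>The inverse of \<Theta> and the induced coaction\<close>

abbreviation "\<Theta>' \<equiv> \<Theta> \<circ> X.I"

lemma \<Theta>'_iso: "\<Theta>' \<in> lmod_iso X.HA X.E.X Y.X"
  using \<Theta> X.I_lmod_iso lmod_hom_comp[of X.I X.HA X.E.X X.HM \<Theta> Y.X]
  by (auto simp: lmod_iso_def simp del: tensor_mod_simps ext_scalars_simps intro: bij_betw_trans)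

lemma \<Theta>'_hom: "\<Theta>' \<in> lmod_hom X.HA X.E.X Y.X"
  using \<Theta>'_iso by (simp add: lmod_iso_def)

text \<open>The inverse ends in the extension along \<eta> \<otimes> id and not in H \<otimes> M, so
  that \<open>ext_map\<close> applies to it; \<open>X.I\<close> has to follow to obtain
  delta-bar.\<close>

definition "\<Omega> = inv_into (carrier X.E.X) \<Theta>'"

lemma \<Omega>_hom: "\<Omega> \<in> lmod_hom X.HA Y.X X.E.X"
  unfolding \<Omega>_def using \<Theta>'_iso X.E.left_module_ext by (rule lmod_iso_inv_into)

lemma \<Omega>_\<Theta>': "x \<in> carrier X.E.X \<Longrightarrow> \<Omega> (\<Theta>' x) = x"
  unfolding \<Omega>_def using \<Theta>'_iso bij_betw_inv_into_left unfolding lmod_iso_def by fastforce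

lemma \<Theta>'_\<Omega>: "y \<in> carrier Y.X \<Longrightarrow> \<Theta>' (\<Omega> y) = y"
  unfolding \<Omega>_def using \<Theta>'_iso bij_betw_inv_into_right unfolding lmod_iso_def by fastforce

definition "induced_coaction m = inv_into (carrier X.HM) \<Theta> (ext_unit A X.HA \<delta> M m)"

lemma induced_coaction_eq:
  assumes "m \<in> carrier M"
  shows "induced_coaction m = X.I (\<Omega> (ext_unit A X.HA \<delta> M m))"
proof -
  have u: "ext_unit A X.HA \<delta> M m \<in> carrier Y.X"
    using assms Y.ext_unit_closed by simp
  show ?thesis
    unfolding induced_coaction_def
  proof (rule inv_into_f_eq)
    show "inj_on \<Theta> (carrier X.HM)"
      using \<Theta> by (auto simp: lmod_iso_def bij_betw_def)
    show "X.I (\<Omega> (ext_unit A X.HA \<delta> M m)) \<in> carrier X.HM"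
      using lmod_hom_closed[OF X.I_lmod_hom] lmod_hom_closed[OF \<Omega>_hom] u by blast
    show "\<Theta> (X.I (\<Omega> (ext_unit A X.HA \<delta> M m))) = ext_unit A X.HA \<delta> M m"
      using \<Theta>'_\<Omega>[OF u] by simp
  qed
qed

text \<open>Makes id \<otimes> delta-bar a legitimate \<open>tensor_map\<close>. Of the three maps
  composing delta-bar, the natural map is K-linear because \<delta>(k1) = k1.\<close>

lemma induced_coaction_hom: "induced_coaction \<in> lmod_hom K X.V X.HV"
proof -
  have "ext_unit A X.HA \<delta> M \<in> lmod_hom K X.V (base_restrict X.HA Y.X)"
  proof (rule lmod_homI)
    fix k m assume "k \<in> carrier K" "m \<in> carrier X.V"
    moreover from this have "\<delta> (k \<odot>\<^bsub>A\<^esub> \<one>\<^bsub>A\<^esub>) = k \<odot>\<^bsub>X.HA\<^esub> \<one>\<^bsub>X.HA\<^esub>"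
      using lmod_hom_smult[OF alg_hom_imp_lmod_hom[OF coaction_hom]]
        ring_hom_one[OF alg_hom_imp_ring_hom[OF coaction_hom]] by simp
    ultimately show "ext_unit A X.HA \<delta> M (k \<odot>\<^bsub>X.V\<^esub> m) = k \<odot>\<^bsub>base_restrict X.HA Y.X\<^esub> ext_unit A X.HA \<delta> M m"
      using Y.ext_unit_smult[of "k \<odot>\<^bsub>A\<^esub> \<one>\<^bsub>A\<^esub>" m] by simp
  qed (simp_all add: Y.ext_unit_closed, simp add: ext_unit_def Y.pure_add[simplified])
  then have "X.I \<circ> (\<Omega> \<circ> ext_unit A X.HA \<delta> M) \<in> lmod_hom K X.V X.HV"
    by (intro lmod_hom_comp[OF _ X.I_lmod_hom_base]
        lmod_hom_comp[OF _ lmod_hom_base_restrict[OF X.HA.assoc_algebra_axioms \<Omega>_hom]])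
  \<comment> \<open>The composite equals \<open>induced_coaction\<close> on M only, so linearity is
    transferred pointwise, using closure of M under its operations.\<close>
  then show ?thesis
    using module_base_restrict[OF A.assoc_algebra_axioms M.left_module_axioms, THEN module.smult_closed]
      module_abelian_group[OF X.modules(3), THEN abelian_group.axioms(1), THEN abelian_monoid.a_closed]
    by (auto simp: lmod_hom_def induced_coaction_eq simp del: base_restrict_simps(4))
qed

section \<open>Collapsing the double extension to H \<otimes> (H \<otimes> M)\<close>

definition "collapse = tensor_map K H XX.V H X.HV id X.I \<circ> XX.I"

lemma tensor_map_id_I:
  shows tensor_map_id_I_hom:
      "tensor_map K H XX.V H X.HV id X.I \<in> lmod_hom K XX.HV (tensor_alg K H X.HV)"
    and tensor_map_id_I_pure: "\<lbrakk>h \<in> carrier H; x \<in> carrier X.E.XG\<rbrakk> \<Longrightarrow>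
      tensor_map K H XX.V H X.HV id X.I (pure_tensor K H XX.V h x) = pure_tensor K H X.HV h (X.I x)"
proof -
  note m = XX.modules(1,3) X.modules(1) module_tensor_alg[OF X.modules(1,3)] lmod_hom_id X.I_lmod_hom_base
  show "tensor_map K H XX.V H X.HV id X.I \<in> lmod_hom K XX.HV (tensor_alg K H X.HV)"
    by (rule tensor_map_lmod_hom[OF m])
  show "tensor_map K H XX.V H X.HV id X.I (pure_tensor K H XX.V h x) = pure_tensor K H X.HV h (X.I x)"
    if "h \<in> carrier H" "x \<in> carrier X.E.XG"
    using tensor_map_pure[OF m, of h x] that by simp
qed

lemma collapse_add:
  "\<lbrakk>x \<in> carrier XX.E.XG; y \<in> carrier XX.E.XG\<rbrakk> \<Longrightarrow>
    collapse (x \<otimes>\<^bsub>XX.E.XG\<^esub> y) = collapse x \<otimes>\<^bsub>tensor_group K H X.HV\<^esub> collapse y"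
  using lmod_hom_add[OF tensor_map_id_I_hom] hom_in_carrier[OF XX.I_hom] hom_mult[OF XX.I_hom]
  by (simp add: collapse_def)

text \<open>\<open>XX.I\<close> undoes the outer extension by letting c act on x, and id \<otimes>
  \<open>X.I\<close> then undoes the inner extension, in which the result still lies.\<close>

lemma collapse_pure:
  assumes "h \<in> carrier H" "c \<in> carrier (tensor_group K H A)" "x \<in> carrier X.E.XG"
  shows "collapse (XX.E.pure (pure_tensor K H X.HA h c) x) = pure_tensor K H X.HV h (X.I (c \<odot>\<^bsub>X.E.X\<^esub> x))"
  using assms XX.I_pure[of h c x] tensor_map_id_I_pure[of h "c \<odot>\<^bsub>X.E.X\<^esub> x"] XX.M.smult_closed[of c x]
  by (simp add: collapse_def)

text \<open>A left inverse is assembled from the inverses of the two stages. Injectivity turns the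
  comparison of collapsed values into an equivalence.\<close>

lemma collapse_inj:
  assumes "collapse x = collapse y" "x \<in> carrier XX.E.X" "y \<in> carrier XX.E.X"
  shows "x = y"
proof -
  obtain J where J: "J \<in> lmod_hom K X.HV XX.V" "\<And>x. x \<in> carrier X.E.X \<Longrightarrow> J (X.I x) = x"
    using X.I_inverse by metis
  obtain J' where J': "J' \<in> lmod_hom K XX.HV (base_restrict HHA XX.E.X)"
    "\<And>x. x \<in> carrier XX.E.X \<Longrightarrow> J' (XX.I x) = x"
    using XX.I_inverse by metis
  note m = X.modules(1) module_tensor_alg[OF X.modules(1,3)] XX.modules(1,3) lmod_hom_id J(1)
  let ?I = "tensor_map K H XX.V H X.HV id X.I" and ?J = "tensor_map K H X.HV H XX.V id J"
  have left_inverse: "?J (?I t) = t" if "t \<in> carrier (tensor_group K H XX.V)" for t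
    using that
  proof (rule XX.THV.tensor_induct)
    fix h x assume "h \<in> carrier H" "x \<in> carrier XX.V"
    then show "?J (?I (pure_tensor K H XX.V h x)) = pure_tensor K H XX.V h x"
      using tensor_map_pure[OF m, of h "X.I x"] J(2)[of x] hom_in_carrier[OF X.I_hom, of x]
      by (simp add: tensor_map_id_I_pure)
  next
    fix x y assume "x \<in> carrier (tensor_group K H XX.V)" "y \<in> carrier (tensor_group K H XX.V)"
      and "?J (?I x) = x" "?J (?I y) = y"
    then show "?J (?I (x \<otimes>\<^bsub>tensor_group K H XX.V\<^esub> y)) = x \<otimes>\<^bsub>tensor_group K H XX.V\<^esub> y"
      using lmod_hom_add[OF tensor_map_id_I_hom, of x y] lmod_hom_closed[OF tensor_map_id_I_hom]
        lmod_hom_add[OF tensor_map_lmod_hom[OF m]] by simp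
  qed
  have "J' (?J (collapse z)) = z" if "z \<in> carrier XX.E.X" for z
    using that left_inverse[of "XX.I z"] hom_in_carrier[OF XX.I_hom, of z] J'(2)[of z]
    by (simp add: collapse_def)
  with assms show ?thesis by metis
qed

text \<open>Stated for any t in H \<otimes> H since \<Delta>(h) need not be pure. Both sides are
  additive in t, and for t = h \<otimes> h' both are h \<otimes> (h' \<otimes> am).\<close>

lemma collapse_comult_pure:
  assumes "t \<in> carrier (tensor_group K H H)" "a \<in> carrier A" "m \<in> carrier M"
  shows "collapse (XX.E.pure (tensor_assoc K H H A (pure_tensor K (tensor_alg K H H) A t a)) (X.E.pure \<one>\<^bsub>X.HA\<^esub> m)) =
    tensor_assoc K H H X.V (pure_tensor K (tensor_alg K H H) X.V t (a \<odot>\<^bsub>M\<^esub> m))"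
proof -
  interpret HH: tensor_pair K H H using X.modules by (intro module_tensor_pair)
  interpret L: tensor_pair K "tensor_alg K H H" A
    using X.modules by (intro module_tensor_pair module_tensor_alg)
  interpret L': tensor_pair K "tensor_alg K H H" X.V
    using X.modules by (intro module_tensor_pair module_tensor_alg)
  note assoc = tensor_assoc_lmod_hom[OF X.modules(1,1,2)] tensor_assoc_lmod_hom[OF X.modules(1,1,3)]
  show ?thesis
    using assms(1)
  proof (induction rule: HH.tensor_induct)
    case (pure h h')
    then show ?case
      using assms(2,3) M.smult_closed[OF assms(2,3)]
      by (simp add: tensor_assoc_pure X.modules collapse_pure X.E.smult_pure X.I_pure
          assoc_algebra_tensor_mult[OF X.algebras])
  next
    case (add s t)
    let ?p = "\<lambda>s. pure_tensor K (tensor_alg K H H) A s a"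
    let ?q = "\<lambda>s. pure_tensor K (tensor_alg K H H) X.V s (a \<odot>\<^bsub>M\<^esub> m)"
    have closed: "?p s \<in> carrier (tensor_group K (tensor_alg K H H) A)" "?p t \<in> carrier (tensor_group K (tensor_alg K H H) A)"
      "?q s \<in> carrier (tensor_group K (tensor_alg K H H) X.V)" "?q t \<in> carrier (tensor_group K (tensor_alg K H H) X.V)"
      using add M.smult_closed[OF assms(2,3)] assms(2) by simp_all
    then have closed': "tensor_assoc K H H A (?p s) \<in> carrier HHA" "tensor_assoc K H H A (?p t) \<in> carrier HHA"
      using lmod_hom_closed[OF assoc(1)] by simp_all
    have "tensor_assoc K H H A (?p (s \<otimes>\<^bsub>tensor_group K H H\<^esub> t)) =
        tensor_assoc K H H A (?p s) \<oplus>\<^bsub>HHA\<^esub> tensor_assoc K H H A (?p t)"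
      using add closed assms(2) L.pure_add_left[of s t a] lmod_hom_add[OF assoc(1), of "?p s" "?p t"] by simp
    moreover have "tensor_assoc K H H X.V (?q (s \<otimes>\<^bsub>tensor_group K H H\<^esub> t)) =
        tensor_assoc K H H X.V (?q s) \<otimes>\<^bsub>tensor_group K H X.HV\<^esub> tensor_assoc K H H X.V (?q t)"
      using add closed M.smult_closed[OF assms(2,3)] L'.pure_add_left[of s t "a \<odot>\<^bsub>M\<^esub> m"]
        lmod_hom_add[OF assoc(2), of "?q s" "?q t"] by simp
    ultimately show ?case
      using add closed' assms(3) XX.E.pure_add(1)[OF closed', of "X.E.pure \<one>\<^bsub>X.HA\<^esub> m"]
      by (simp add: collapse_add)
  qed
qed

text \<open>For x = (h \<otimes> a) \<otimes> m the identification moves \<open>\<Delta>_A\<close>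
  of h \<otimes> a into the outer factor, leaving 1 \<otimes> m inside; collapsing this applies
  \<Delta> \<otimes> id to h \<otimes> am, which is the image of x under \<open>X.I\<close>.\<close>

lemma collapse_ident_comult:
  assumes "x \<in> carrier X.E.X"
  shows "collapse (ext_ident A X.HA X.HA HHA \<eta>_A \<Delta>_A \<eta>_A \<eta>_HA M (S3.\<psi>'.pure \<one>\<^bsub>HHA\<^esub> x)) =
    comult_tensor K H \<Delta> X.V (X.I x)"
proof -
  note ident = lmod_homD[OF S3'.ext_ident_lmod_hom, simplified]
  note I = hom_mult[OF X.I_hom] hom_in_carrier[OF X.I_hom]
  note comult = lmod_homD[OF comult_tensor_lmod_hom[OF X.modules(1,3) alg_hom_imp_lmod_hom[OF comult_hom]], simplified]
  note one = XX.HA.A.one_closed[simplified]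
  show ?thesis
    using assms
  proof (induction rule: X.E_induct)
    case (pure h a m)
    then have "\<Delta>_A (pure_tensor K H A h a) \<in> carrier HHA"
      by (intro lmod_hom_closed[OF alg_hom_imp_lmod_hom[OF \<Delta>_A_alg_hom]]) simp
    then have "collapse (ext_ident A X.HA X.HA HHA \<eta>_A \<Delta>_A \<eta>_A \<eta>_HA M
        (S3.\<psi>'.pure \<one>\<^bsub>HHA\<^esub> (X.E.pure (pure_tensor K H A h a) m))) =
        collapse (XX.E.pure (\<Delta>_A (pure_tensor K H A h a)) (X.E.pure \<one>\<^bsub>X.HA\<^esub> m))"
      using pure S3'.ext_ident_pure[of "\<one>\<^bsub>HHA\<^esub>" "pure_tensor K H A h a" m]
        XX.HA.A.l_one[of "\<Delta>_A (pure_tensor K H A h a)"] by simp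
    also have "\<dots> = comult_tensor K H \<Delta> X.V (pure_tensor K H X.V h (a \<odot>\<^bsub>M\<^esub> m))"
      using pure lmod_hom_closed[OF alg_hom_imp_lmod_hom[OF comult_hom], of h] M.smult_closed[of a m]
        collapse_comult_pure[of "\<Delta> h" a m]
      by (simp add: \<Delta>_A_pure comult_tensor_pure X.modules alg_hom_imp_lmod_hom[OF comult_hom])
    finally show ?case
      using pure by (simp add: X.I_pure)
  next
    case (add x y)
    then show ?case
      using one S3.\<psi>'.pure_add(2)[of "\<one>\<^bsub>HHA\<^esub>" x y]
      by (simp add: ident collapse_add I comult)
  qed
qed

text \<open>For x = (h \<otimes> 1) \<otimes> m the identification yields (h \<otimes> 1) \<otimes>
  (1 \<otimes> m); \<Omega> turns the inner 1 \<otimes> m into the element that \<open>X.I\<close>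
  sends to delta-bar(m), so the collapse is h \<otimes> delta-bar(m).\<close>

lemma collapse_ident_coaction:
  assumes "x \<in> carrier X.E.X"
  shows "collapse (ext_map X.HA HHA \<eta>_HA Y.X X.E.X \<Omega>
      (ext_ident A X.HA X.HA HHA \<eta>_A id_\<delta> \<delta> \<eta>_HA M (S1.\<psi>'.pure \<one>\<^bsub>HHA\<^esub> x))) =
    tensor_map K H X.V H X.HV id induced_coaction (X.I x)"
proof -
  obtain J where J: "J \<in> lmod_hom K X.HV XX.V"
    "\<And>h m. \<lbrakk>h \<in> carrier H; m \<in> carrier M\<rbrakk> \<Longrightarrow> J (pure_tensor K H X.V h m) = X.E.pure (pure_tensor K H A h \<one>\<^bsub>A\<^esub>) m"
    "\<And>x. x \<in> carrier X.E.X \<Longrightarrow> J (X.I x) = x"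
    using X.I_inverse by metis
  note J' = lmod_homD[OF J(1), simplified]
  note ident = lmod_homD[OF S1'.ext_ident_lmod_hom, simplified]
  note \<Omega>_ext = S1.\<psi>.scalar_extension_axioms XX.E.scalar_extension_axioms \<Omega>_hom
  note ext = lmod_homD[OF ext_map_lmod_hom[OF \<Omega>_ext], simplified]
  note mod = X.modules(1,3) X.modules(1) module_tensor_alg[OF X.modules(1,3)] lmod_hom_id induced_coaction_hom
  note coact = lmod_homD[OF tensor_map_lmod_hom[OF mod], simplified]
  note one = XX.HA.A.one_closed[simplified]
  let ?G = "\<lambda>x. collapse (ext_map X.HA HHA \<eta>_HA Y.X X.E.X \<Omega>
      (ext_ident A X.HA X.HA HHA \<eta>_A id_\<delta> \<delta> \<eta>_HA M (S1.\<psi>'.pure \<one>\<^bsub>HHA\<^esub> x)))"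
    and ?C = "tensor_map K H X.V H X.HV id induced_coaction"
  \<comment> \<open>Writing x as \<open>J t\<close> and inducting on t keeps the component in A
    equal to 1; a general a would leave a factor \<delta>(a) to be moved through \<Omega>.\<close>
  have "?G (J t) = ?C t" if "t \<in> carrier (tensor_group K H X.V)" for t
    using that
  proof (rule X.THV.tensor_induct)
    fix h m assume "h \<in> carrier H" "m \<in> carrier X.V"
    then have hm: "h \<in> carrier H" "m \<in> carrier M" by auto
    let ?u = "Y.pure \<one>\<^bsub>X.HA\<^esub> m"
    have u: "?u \<in> carrier Y.X" using hm by simp
    have \<Omega>u: "\<Omega> ?u \<in> carrier X.E.X"
      using lmod_hom_closed[OF \<Omega>_hom u] .
    have h1: "pure_tensor K H X.HA h \<one>\<^bsub>X.HA\<^esub> \<in> carrier HHA"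
      using hm by simp
    have "id_\<delta> (pure_tensor K H A h \<one>\<^bsub>A\<^esub>) = pure_tensor K H X.HA h \<one>\<^bsub>X.HA\<^esub>"
      using hm ring_hom_one[OF alg_hom_imp_ring_hom[OF coaction_hom]] by (simp add: id_\<delta>_pure)
    then have "ext_ident A X.HA X.HA HHA \<eta>_A id_\<delta> \<delta> \<eta>_HA M (S1.\<psi>'.pure \<one>\<^bsub>HHA\<^esub> (J (pure_tensor K H X.V h m))) =
        S1.\<psi>.pure (pure_tensor K H X.HA h \<one>\<^bsub>X.HA\<^esub>) ?u"
      using hm S1'.ext_ident_pure[of "\<one>\<^bsub>HHA\<^esub>" "pure_tensor K H A h \<one>\<^bsub>A\<^esub>" m] XX.HA.A.l_one[OF h1]
        XX.HA.A.one_closed by (simp add: J(2))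
    moreover have "collapse (XX.E.pure (pure_tensor K H X.HA h \<one>\<^bsub>X.HA\<^esub>) (\<Omega> ?u)) = pure_tensor K H X.HV h (X.I (\<Omega> ?u))"
      using hm \<Omega>u X.HA.A.one_closed collapse_pure[of h "\<one>\<^bsub>X.HA\<^esub>" "\<Omega> ?u"] XX.M.smult_one[OF \<Omega>u] by simp
    ultimately show "?G (J (pure_tensor K H X.V h m)) = ?C (pure_tensor K H X.V h m)"
      using hm h1 u ext_map_pure[OF \<Omega>_ext h1 u] tensor_map_pure[OF mod, of h m]
      by (simp add: induced_coaction_eq ext_unit_def)
  next
    fix s t assume "s \<in> carrier (tensor_group K H X.V)" "t \<in> carrier (tensor_group K H X.V)"
      and "?G (J s) = ?C s" "?G (J t) = ?C t"
    then show "?G (J (s \<otimes>\<^bsub>tensor_group K H X.V\<^esub> t)) = ?C (s \<otimes>\<^bsub>tensor_group K H X.V\<^esub> t)"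
      using one S1.\<psi>'.pure_add(2)[of "\<one>\<^bsub>HHA\<^esub>" "J s" "J t"]
      by (simp add: J' ident ext collapse_add coact)
  qed
  from this[of "X.I x"] show ?thesis
    using assms J(3)[of x] hom_in_carrier[OF X.I_hom, of x] by simp
qed

section \<open>The cocycle condition against coassociativity\<close>

lemma cocycle_iff_coassociative:
  "(\<forall>x \<in> carrier XX.E.X.
      ext_ident A X.HA X.HA HHA \<delta> id_\<delta> \<delta> \<Delta>_A M
        (ext_map X.HA HHA id_\<delta> X.E.X Y.X \<Theta>'
          (ext_ident A X.HA X.HA HHA \<delta> \<eta>_HA \<eta>_A id_\<delta> M
            (ext_map X.HA HHA \<eta>_HA X.E.X Y.X \<Theta>' x)))
    = ext_map X.HA HHA \<Delta>_A X.E.X Y.X \<Theta>'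
        (ext_ident A X.HA X.HA HHA \<eta>_A \<eta>_HA \<eta>_A \<Delta>_A M x))
   \<longleftrightarrow> (\<forall>m \<in> carrier M.
      comult_tensor K H \<Delta> X.V (induced_coaction m) = tensor_map K H X.V H X.HV id induced_coaction (induced_coaction m))"
    (is "(\<forall>x\<in>_. ?i2 (?d (?i1 (?e x))) = ?c (?i3 x)) \<longleftrightarrow> _")
proof -
  let ?j1 = "ext_ident A X.HA X.HA HHA \<eta>_A id_\<delta> \<delta> \<eta>_HA M"
    and ?j2 = "ext_ident A X.HA X.HA HHA \<delta> \<Delta>_A \<delta> id_\<delta> M"
    and ?j3 = "ext_ident A X.HA X.HA HHA \<eta>_A \<Delta>_A \<eta>_A \<eta>_HA M"
    and ?e' = "ext_map X.HA HHA \<eta>_HA Y.X X.E.X \<Omega>"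
    and ?d' = "ext_map X.HA HHA id_\<delta> Y.X X.E.X \<Omega>"
    and ?c' = "ext_map X.HA HHA \<Delta>_A Y.X X.E.X \<Omega>"
  note e_ext = XX.E.scalar_extension_axioms S1.\<psi>.scalar_extension_axioms
    and d_ext = S1.\<psi>'.scalar_extension_axioms S2.\<psi>.scalar_extension_axioms
    and c_ext = S3.\<psi>'.scalar_extension_axioms S2.\<psi>'.scalar_extension_axioms
  note \<Theta>_homs = ext_map_lmod_hom[OF e_ext \<Theta>'_hom] ext_map_lmod_hom[OF d_ext \<Theta>'_hom] ext_map_lmod_hom[OF c_ext \<Theta>'_hom]
    and \<Omega>_homs = ext_map_lmod_hom[OF e_ext(2,1) \<Omega>_hom] ext_map_lmod_hom[OF d_ext(2,1) \<Omega>_hom]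
      ext_map_lmod_hom[OF c_ext(2,1) \<Omega>_hom]
    and ident_homs = S1.ext_ident_lmod_hom S2.ext_ident_lmod_hom S3.ext_ident_lmod_hom
      S1'.ext_ident_lmod_hom S2'.ext_ident_lmod_hom S3'.ext_ident_lmod_hom
  note closed = \<Theta>_homs[THEN lmod_hom_closed] \<Omega>_homs[THEN lmod_hom_closed] ident_homs[THEN lmod_hom_closed]
  note inverse =
    ext_map_inverse[OF e_ext \<Theta>'_hom \<Omega>_hom \<Omega>_\<Theta>'] ext_map_inverse[OF e_ext(2,1) \<Omega>_hom \<Theta>'_hom \<Theta>'_\<Omega>]
    ext_map_inverse[OF d_ext \<Theta>'_hom \<Omega>_hom \<Omega>_\<Theta>'] ext_map_inverse[OF d_ext(2,1) \<Omega>_hom \<Theta>'_hom \<Theta>'_\<Omega>]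
    ext_map_inverse[OF c_ext \<Theta>'_hom \<Omega>_hom \<Omega>_\<Theta>'] ext_map_inverse[OF c_ext(2,1) \<Omega>_hom \<Theta>'_hom \<Theta>'_\<Omega>]
    S1.ext_ident_inverse S1'.ext_ident_inverse S2.ext_ident_inverse S2'.ext_ident_inverse
    S3.ext_ident_inverse S3'.ext_ident_inverse
  \<comment> \<open>The inverses of the two sides: \<open>?j1\<close>, \<open>?j2\<close>,
    \<open>?j3\<close> reverse the identifications, and the primed maps are the extensions of
    \<Omega>.\<close>
  let ?L = "?e' \<circ> (?j1 \<circ> (?d' \<circ> ?j2))" and ?R = "?j3 \<circ> ?c'"
  \<comment> \<open>The simplifier is confined to \<open>closed\<close> and \<open>inverse\<close>
    because its default rules would rewrite the carriers of extensions to those of tensor groups,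
    away from the form of these facts.\<close>
  have "(\<forall>x\<in>carrier XX.E.X. ?i2 (?d (?i1 (?e x))) = ?c (?i3 x)) \<longleftrightarrow>
      (\<forall>y\<in>carrier S2.\<psi>'.X. ?L y = ?R y)"
    by (rule inverses_agree_iff)
      (simp_all only: o_apply closed inverse)
  also have "\<dots> \<longleftrightarrow> (\<forall>m\<in>carrier M. ?L (ext_unit X.HA HHA \<Delta>_A Y.X (ext_unit A X.HA \<delta> M m)) =
      ?R (ext_unit X.HA HHA \<Delta>_A Y.X (ext_unit A X.HA \<delta> M m)))"
  proof -
    have L: "?L \<in> lmod_hom HHA S2.\<psi>'.X XX.E.X"
      by (rule lmod_hom_comp[OF lmod_hom_comp[OF lmod_hom_comp]])
        (rule S2'.ext_ident_lmod_hom \<Omega>_homs S1'.ext_ident_lmod_hom)+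
    have R: "?R \<in> lmod_hom HHA S2.\<psi>'.X XX.E.X"
      by (rule lmod_hom_comp) (rule S3'.ext_ident_lmod_hom \<Omega>_homs)+
    have "ext_unit X.HA HHA \<Delta>_A Y.X (ext_unit A X.HA \<delta> M m) \<in> carrier S2.\<psi>'.X" if "m \<in> carrier M" for m
      using that S2.\<psi>'.ext_unit_closed Y.ext_unit_closed by simp
    then show ?thesis
      using S2'.unit_generates[OF L R] by blast
  qed
  also have "\<dots> \<longleftrightarrow> (\<forall>m\<in>carrier M.
      comult_tensor K H \<Delta> X.V (induced_coaction m) = tensor_map K H X.V H X.HV id induced_coaction (induced_coaction m))"
  proof (rule ball_cong[OF refl])
    fix m assume m: "m \<in> carrier M"
    let ?u = "ext_unit A X.HA \<delta> M m"
    let ?w = "ext_unit X.HA HHA \<Delta>_A Y.X ?u"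
    have u: "?u \<in> carrier Y.X" using m Y.ext_unit_closed by simp
    have w: "?w \<in> carrier S2.\<psi>'.X" using u S2.\<psi>'.ext_unit_closed by simp
    have \<Omega>u: "\<Omega> ?u \<in> carrier X.E.X" using lmod_hom_closed[OF \<Omega>_hom u] .
    have one: "\<one>\<^bsub>HHA\<^esub> \<in> carrier HHA" by (rule XX.HA.A.one_closed)
    \<comment> \<open>\<open>ext_ident_pure\<close> puts \<open>\<Delta>_A\<close> of the unit into
      the outer factor; as it is the unit, the generator is carried to the generator.\<close>
    have "\<Delta>_A \<one>\<^bsub>X.HA\<^esub> = \<one>\<^bsub>HHA\<^esub>"
      using ring_hom_one[OF alg_hom_imp_ring_hom[OF \<Delta>_A_alg_hom]] .
    then have "?j2 ?w = S2.\<psi>.pure \<one>\<^bsub>HHA\<^esub> ?u"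
      using S2'.ext_ident_pure[OF one X.HA.A.one_closed m] XX.HA.A.l_one[OF one]
      by (simp only: ext_unit_def)
    then have "?d' (?j2 ?w) = S1.\<psi>'.pure \<one>\<^bsub>HHA\<^esub> (\<Omega> ?u)"
      using ext_map_pure[OF d_ext(2,1) \<Omega>_hom one u] by (simp only:)
    then have "collapse (?L ?w) = tensor_map K H X.V H X.HV id induced_coaction (induced_coaction m)"
      using collapse_ident_coaction[OF \<Omega>u] induced_coaction_eq[OF m] by (simp only: o_apply)
    moreover have "?c' ?w = S3.\<psi>'.pure \<one>\<^bsub>HHA\<^esub> (\<Omega> ?u)"
      using ext_map_pure[OF c_ext(2,1) \<Omega>_hom one u] unfolding ext_unit_def .
    then have "collapse (?R ?w) = comult_tensor K H \<Delta> X.V (induced_coaction m)"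
      using collapse_ident_comult[OF \<Omega>u] induced_coaction_eq[OF m] by (simp only: o_apply)
    moreover have "?L ?w = ?R ?w \<longleftrightarrow> collapse (?L ?w) = collapse (?R ?w)"
      using collapse_inj[of "?L ?w" "?R ?w"] closed w by (auto simp del: ext_scalars_simps)
    ultimately show "?L ?w = ?R ?w \<longleftrightarrow>
        comult_tensor K H \<Delta> X.V (induced_coaction m) = tensor_map K H X.V H X.HV id induced_coaction (induced_coaction m)"
      by auto
  qed
  finally show ?thesis .
qed

end

theorem corollary2p3:
  fixes K :: "('k, 'z) ring_scheme"
    and H :: "('k, 'h) module"
    and A :: "('k, 'a) module"
    and M :: "('a, 'm) module"
    and \<Delta> :: "'h \<Rightarrow> ('h, 'h) tensor"
    and \<epsilon> :: "'h \<Rightarrow> 'k"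
    and \<delta> :: "'a \<Rightarrow> ('h, 'a) tensor"
    and \<Theta> :: "('h, 'm) tensor \<Rightarrow> (('h, 'a) tensor, 'm) tensor"
  defines "HA \<equiv> tensor_alg K H A"
    and "HHA \<equiv> tensor_alg K H (tensor_alg K H A)"
    and "V \<equiv> base_restrict A M"
    and "\<eta>_A \<equiv> unit_tensor K H A"
    and "\<eta>_HA \<equiv> unit_tensor K H (tensor_alg K H A)"
    and "\<Delta>_A \<equiv> comult_tensor K H \<Delta> A"
    and "id_\<delta> \<equiv> tensor_map K H A H (tensor_alg K H A) id \<delta>"
  defines "X \<equiv> ext_scalars A HA \<eta>_A M"
    and "Y \<equiv> ext_scalars A HA \<delta> M"
  defines "\<Theta>' \<equiv> \<Theta> \<circ> ext_unit_tensor_ident K H A M"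
    and "\<delta>_bar \<equiv> (\<lambda>m. inv_into (carrier (tensor_mod K H A M)) \<Theta> (ext_unit A HA \<delta> M m))"
  assumes "field K"
    and "bialgebra K H \<Delta> \<epsilon>"
    and "assoc_algebra K A"
    and "left_coaction K H \<Delta> \<epsilon> A \<delta>"
    and "left_module A M"
    and "\<Theta> \<in> lmod_hom HA (tensor_mod K H A M) Y"
    and "\<Theta> \<in> lmod_iso HA (tensor_mod K H A M) Y"
  shows "(\<forall>x \<in> carrier (ext_scalars HA HHA \<eta>_HA X).
            ext_ident A HA HA HHA \<delta> id_\<delta> \<delta> \<Delta>_A M
              (ext_map HA HHA id_\<delta> X Y \<Theta>'
                (ext_ident A HA HA HHA \<delta> \<eta>_HA \<eta>_A id_\<delta> M
                  (ext_map HA HHA \<eta>_HA X Y \<Theta>' x)))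
          = ext_map HA HHA \<Delta>_A X Y \<Theta>'
              (ext_ident A HA HA HHA \<eta>_A \<eta>_HA \<eta>_A \<Delta>_A M x))
     \<longleftrightarrow> (\<forall>m \<in> carrier M.
            comult_tensor K H \<Delta> V (\<delta>_bar m)
          = tensor_map K H V H (tensor_alg K H V) id \<delta>_bar (\<delta>_bar m))"
proof -
  \<comment> \<open>The eleven \<open>defines\<close> come first in \<open>assms\<close>; 15 to 18
    are the coaction, the module and the two facts about \<Theta>.\<close>
  interpret coaction_iso K H \<Delta> \<epsilon> A \<delta> M \<Theta>
    using assms(15-18) unfolding HA_def Y_def
    by (intro coaction_iso.intro coaction_iso_axioms.intro)
  have "\<delta>_bar = induced_coaction"
    by (simp only: fun_eq_iff \<delta>_bar_def HA_def induced_coaction_def) simp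
  then show ?thesis
    using cocycle_iff_coassociative
    unfolding HA_def HHA_def V_def \<eta>_A_def \<eta>_HA_def \<Delta>_A_def id_\<delta>_def X_def Y_def \<Theta>'_def
    by (simp only:)
qed

end
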